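(* Let $\mathcal{P}$ be the universal bundle on $\mathbb{H}_{\mathbb{C}}\mathbb{P}^1\cong Gr(2,\mathbb{C}^4)$, viewed as a subbundle of the trivial bundle with fibre $\mathbb{C}^4$, and let $\nabla$ be the connection on $\mathcal{P}$ obtained by projecting the trivial smooth connection on $\mathbb{H}_{\mathbb{C}}\mathbb{P}^1\times\mathbb{C}^4$ onto $\mathcal{P}$ orthogonally with respect to the standard Hermitian product on $\mathbb{C}^4$. Then the restriction of $(\mathcal{P},\nabla)$ to $\mathbb{H}$ is the basic Euclidean instanton, and its restriction to $\mathbb{H}_{\mathbb{R}}\mathbb{P}^1$ is the basic split anti-instanton.
   Context: $\mathbb{H}_{\mathbb{C}}=M_2(\mathbb{C})$; $\mathbb{H}=\{Z\in\mathbb{H}_{\mathbb{C}}:z_{22}=\bar z_{11},\ z_{12}=-\bar z_{21}\}$ (quaternions); $\mathbb{H}_{\mathbb{R}}=M_2(\mathbb{R})$ (split quaternions). $\mathbb{H}_{\mathbb{C}}\mathbb{P}^1$ is the set of pairs $(Z,W)\in\mathbb{H}_{\mathbb{C}}^2$ such that there is no nonzero $Q\in\mathbb{H}_{\mathbb{C}}$ with $ZQ=WQ=0$, modulo $(Z,W)\sim(Zq,Wq)$ for invertible $q\in\mathbb{H}_{\mathbb{C}}$; the class is $[Z:W]$. It is identified with $Gr(2,\mathbb{C}^4)$ by sending $[Z:W]$ to the column span of the $4\times2$ matrix $\begin{pmatrix} Z \\ W \end{pmatrix}$, and this column span is the fibre of $\mathcal{P}$ at $[Z:W]$. $\mathbb{H}_{\mathbb{C}}$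 is embedded as $\{[Z:1]\}$. $\mathbb{H}_{\mathbb{R}}\mathbb{P}^1$ is defined in the same way from $\mathbb{H}_{\mathbb{R}}$ and is a real submanifold of $\mathbb{H}_{\mathbb{C}}\mathbb{P}^1$; $\mathbb{H}$ and $\mathbb{H}_{\mathbb{R}}$ are embedded as the points $[Z:1]$ with $Z$ in $\mathbb{H}$, resp. $\mathbb{H}_{\mathbb{R}}$. With the quaternion $x=(x_1,x_2,x_3,x_4)\leftrightarrow\begin{pmatrix} x_1+ix_4 & x_2+ix_3 \\ -x_2+ix_3 & x_1-ix_4 \end{pmatrix}$ and $\bar x=(x_1,-x_2,-x_3,-x_4)$, the basic Euclidean instanton is the connection on $\mathbb{H}$ with potential $(1+\bar xx)^{-1}\bar x\,dx$. The basic split anti-instanton is the connection with potential $(1+X^tX)^{-1}X^tdX$ on $\mathbb{H}_{\mathbb{R}}$, together with its extension to $\mathbb{H}_{\mathbb{R}}\mathbb{P}^1$. Solutions are identified up to gauge equivalence; the structure group of $\mathcal{P}$ is $U(2)$, and the restrictions are regarded as connections whose structure group reduces to $Sp(1)$ on $\mathbb{H}$ and to $O(2)$ on $\mathbb{H}_{\mathbb{R}}$. *)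

theory Defs
  imports "HOL-Analysis.Analysis"
begin

section \<open>Smooth maps between Euclidean spaces\<close>

text \<open>Only meant for open \<open>S\<close> and finite-dimensional domains.\<close>

fun higher_differentiable_on ::
  "'a::euclidean_space set \<Rightarrow> ('a \<Rightarrow> 'b::real_normed_vector) \<Rightarrow> nat \<Rightarrow> bool" where
  "higher_differentiable_on S f 0 \<longleftrightarrow> continuous_on S f"
| "higher_differentiable_on S f (Suc n) \<longleftrightarrow>
     (\<forall>x\<in>S. f differentiable (at x)) \<and>
     (\<forall>v. higher_differentiable_on S (\<lambda>x. frechet_derivative f (at x) v) n)"

definition smooth_on :: "'a::euclidean_space set \<Rightarrow> ('a \<Rightarrow> 'b::real_normed_vector) \<Rightarrow> bool" where
  "smooth_on S f \<longleftrightarrow> (\<forall>n. higher_differentiable_on S f n)"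


section \<open>The projective lines over the matrix algebras\<close>

type_synonym 'a hpair = "('a^2^2) \<times> ('a^2^2)"

definition hom_pairs :: "'a::field hpair set" where
  "hom_pairs = {(Z, W). \<not> (\<exists>Q::'a^2^2. Q \<noteq> 0 \<and> Z ** Q = 0 \<and> W ** Q = 0)}"

definition hom_act :: "'a::field hpair \<Rightarrow> 'a^2^2 \<Rightarrow> 'a hpair" where
  "hom_act u q = (fst u ** q, snd u ** q)"

definition hom_rel :: "('a::field hpair \<times> 'a hpair) set" where
  "hom_rel = {(u, v). u \<in> hom_pairs \<and> v \<in> hom_pairs \<and> (\<exists>q. invertible q \<and> v = hom_act u q)}"

definition hom_class :: "'a::field hpair \<Rightarrow> 'a hpair set" where
  "hom_class u = hom_rel `` {u}"

definition HCP1 :: "complex hpair set set" where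
  "HCP1 = hom_pairs // hom_rel"

definition HRP1 :: "real hpair set set" where
  "HRP1 = hom_pairs // hom_rel"

definition cmat :: "real^2^2 \<Rightarrow> complex^2^2" where
  "cmat = map_matrix complex_of_real"

text \<open>The inclusion of \<open>HRP1\<close> in \<open>HCP1\<close>; the classes in the union below all coincide.\<close>

definition hrp1_embed :: "real hpair set \<Rightarrow> complex hpair set" where
  "hrp1_embed p = (\<Union>u\<in>p. hom_class (cmat (fst u), cmat (snd u)))"

definition hc_embed :: "complex^2^2 \<Rightarrow> complex hpair set" where
  "hc_embed Z = hom_class (Z, mat 1)"


section \<open>The universal bundle and the projected connection\<close>

definition stack :: "'a::field hpair \<Rightarrow> 'a^2^4" where
  "stack u = vector [fst u $ 1, fst u $ 2, snd u $ 1, snd u $ 2]"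

definition universal_bundle :: "complex hpair set \<Rightarrow> (complex^4) set" where
  "universal_bundle p = (\<Union>u\<in>p. range (\<lambda>c. stack u *v c))"

definition herm :: "complex^'n \<Rightarrow> complex^'n \<Rightarrow> complex" where
  "herm x y = (\<Sum>i\<in>UNIV. cnj (x $ i) * y $ i)"

definition herm_proj :: "(complex^'n) set \<Rightarrow> complex^'n \<Rightarrow> complex^'n" where
  "herm_proj V y = (THE z. z \<in> V \<and> (\<forall>w\<in>V. herm w (y - z) = 0))"

text \<open>
  The map \<^term>\<open>hom_class\<close> from the open set \<^term>\<open>hom_pairs\<close> onto \<^term>\<open>HCP1\<close> is the
  quotient by a free and proper action, hence a surjective submersion. The manifold structure
  of \<^term>\<open>HCP1\<close> is described through it: a set is open, or a function on it smooth, iff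
  its pullback to \<^term>\<open>hom_pairs\<close> is, and a tangent vector at \<open>hom_class u\<close> is the
  image under the differential of \<^term>\<open>hom_class\<close> of a pair \<open>v\<close> based at \<open>u\<close>.
  So \<open>trivial_connection s u v\<close> is the derivative of \<open>s\<close> along that tangent vector.
\<close>

definition hcp1_preimage :: "complex hpair set set \<Rightarrow> complex hpair set" where
  "hcp1_preimage \<Omega> = {u \<in> hom_pairs. hom_class u \<in> \<Omega>}"

definition hcp1_open :: "complex hpair set set \<Rightarrow> bool" where
  "hcp1_open \<Omega> \<longleftrightarrow> \<Omega> \<subseteq> HCP1 \<and> open (hcp1_preimage \<Omega>)"

type_synonym covariant_derivative =
  "(complex hpair set \<Rightarrow> complex^4) \<Rightarrow> complex hpair \<Rightarrow> complex hpair \<Rightarrow> complex^4"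

definition trivial_connection :: covariant_derivative where
  "trivial_connection s u v = frechet_derivative (\<lambda>u. s (hom_class u)) (at u) v"

definition projected_connection ::
  "(complex hpair set \<Rightarrow> (complex^4) set) \<Rightarrow> covariant_derivative" where
  "projected_connection E s u v = herm_proj (E (hom_class u)) (trivial_connection s u v)"


section \<open>Frames, connection forms and restriction\<close>

definition is_basis_matrix :: "complex^2^4 \<Rightarrow> (complex^4) set \<Rightarrow> bool" where
  "is_basis_matrix f V \<longleftrightarrow> inj (\<lambda>c. f *v c) \<and> range (\<lambda>c. f *v c) = V"

definition unitary_frame :: "complex^2^4 \<Rightarrow> bool" where
  "unitary_frame f \<longleftrightarrow> (\<forall>i j. herm (column i f) (column j f) = (if i = j then 1 else 0))"

definition local_frame ::
  "(complex hpair set \<Rightarrow> (complex^4) set) \<Rightarrow> complex hpair set set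
    \<Rightarrow> (complex hpair set \<Rightarrow> complex^2^4) \<Rightarrow> bool" where
  "local_frame E \<Omega> \<sigma> \<longleftrightarrow>
     hcp1_open \<Omega> \<and>
     smooth_on (hcp1_preimage \<Omega>) (\<lambda>u. \<sigma> (hom_class u)) \<and>
     (\<forall>p\<in>\<Omega>. is_basis_matrix (\<sigma> p) (E p))"

text \<open>\<open>\<theta> u v\<close> is the value on \<open>v\<close> of the pullback to \<^term>\<open>hom_pairs\<close> of the
  matrix-valued form \<open>\<theta>\<close> with \<open>\<nabla>\<sigma> = \<sigma>\<theta>\<close>.\<close>

definition frame_connection_form ::
  "covariant_derivative \<Rightarrow> complex hpair set set \<Rightarrow> (complex hpair set \<Rightarrow> complex^2^4)
    \<Rightarrow> (complex hpair \<Rightarrow> complex hpair \<Rightarrow> complex^2^2) \<Rightarrow> bool" where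
  "frame_connection_form D \<Omega> \<sigma> \<theta> \<longleftrightarrow>
     (\<forall>u\<in>hcp1_preimage \<Omega>. \<forall>v j.
        D (\<lambda>p. column j (\<sigma> p)) u v = \<sigma> (hom_class u) *v column j (\<theta> u v))"

text \<open>
  A bundle with connection pulled back to a Euclidean space is represented by the relation
  holding of \<open>(S, e, \<alpha>)\<close> iff \<open>e\<close> is a smooth frame over the open set \<open>S\<close> and \<open>\<alpha>\<close> is the
  connection form in this frame.
\<close>

type_synonym 'e framed_connection =
  "'e set \<Rightarrow> ('e \<Rightarrow> complex^2^4) \<Rightarrow> ('e \<Rightarrow> 'e \<Rightarrow> complex^2^2) \<Rightarrow> bool"

text \<open>
  The pullback of \<open>(E, D)\<close> along a smooth map \<open>\<phi>\<close> into \<^term>\<open>HCP1\<close>. Near each point \<open>\<phi>\<close>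
  lifts to a smooth \<open>\<Phi>\<close> with values in \<^term>\<open>hom_pairs\<close>. The pullback of an ambient local
  frame \<open>\<sigma>\<close> has the pullback of the form of \<open>\<sigma>\<close> as connection form, and the form in the frame
  \<open>e = (\<sigma> \<circ> \<phi>) g\<close> follows from it by the gauge transformation rule
  \<open>\<alpha> = g\<^sup>-\<^sup>1 (\<phi>\<^sup>*\<theta>) g + g\<^sup>-\<^sup>1 dg\<close>.
\<close>

definition restricted_connection ::
  "(complex hpair set \<Rightarrow> (complex^4) set) \<Rightarrow> covariant_derivative
    \<Rightarrow> ('e::euclidean_space \<Rightarrow> complex hpair set) \<Rightarrow> 'e framed_connection" where
  "restricted_connection E D \<phi> S e \<alpha> \<longleftrightarrow>
     open S \<and> smooth_on S e \<and> (\<forall>x\<in>S. is_basis_matrix (e x) (E (\<phi> x))) \<and>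
     (\<forall>x\<in>S. \<exists>N \<Phi> \<Omega> \<sigma> \<theta> g.
        open N \<and> x \<in> N \<and> N \<subseteq> S \<and>
        smooth_on N \<Phi> \<and> (\<forall>y\<in>N. \<Phi> y \<in> hom_pairs \<and> hom_class (\<Phi> y) = \<phi> y) \<and>
        (\<forall>y\<in>N. \<phi> y \<in> \<Omega>) \<and> local_frame E \<Omega> \<sigma> \<and> frame_connection_form D \<Omega> \<sigma> \<theta> \<and>
        smooth_on N g \<and>
        (\<forall>y\<in>N. invertible (g y) \<and> e y = \<sigma> (\<phi> y) ** g y \<and>
          (\<forall>v. \<alpha> y v =
             matrix_inv (g y) ** \<theta> (\<Phi> y) (frechet_derivative \<Phi> (at y) v) ** g y
             + matrix_inv (g y) ** frechet_derivative g (at y) v)))"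


section \<open>The basic Euclidean instanton\<close>

definition quaternions :: "(complex^2^2) set" where
  "quaternions = {Z. Z $ 2 $ 2 = cnj (Z $ 1 $ 1) \<and> Z $ 1 $ 2 = - cnj (Z $ 2 $ 1)}"

definition quat :: "real^4 \<Rightarrow> complex^2^2" where
  "quat x = vector [vector [Complex (x $ 1) (x $ 4), Complex (x $ 2) (x $ 3)],
                    vector [Complex (- x $ 2) (x $ 3), Complex (x $ 1) (- x $ 4)]]"

definition qconj :: "real^4 \<Rightarrow> real^4" where
  "qconj x = vector [x $ 1, - x $ 2, - x $ 3, - x $ 4]"

lemma range_quat: "range quat = quaternions"
proof
  show "range quat \<subseteq> quaternions"
    by (auto simp: quat_def quaternions_def complex_eq_iff)
  show "quaternions \<subseteq> range quat"
  proof
    fix Z assume Z: "Z \<in> quaternions"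
    have "Z = quat (vector [Re (Z$1$1), Re (Z$1$2), Im (Z$1$2), Im (Z$1$1)])"
      using Z by (auto simp: quat_def quaternions_def complex_eq_iff vec_eq_iff forall_2
                       vector_def)
    then show "Z \<in> range quat" by blast
  qed
qed

text \<open>Since \<^term>\<open>quat\<close> is linear, \<open>quat v\<close> is the value of \<open>dx\<close> on \<open>v\<close>.\<close>

definition euclidean_potential :: "real^4 \<Rightarrow> real^4 \<Rightarrow> complex^2^2" where
  "euclidean_potential x v =
     matrix_inv (mat 1 + quat (qconj x) ** quat x) ** quat (qconj x) ** quat v"

text \<open>
  A bundle with connection over the quaternions, in the coordinates \<^term>\<open>quat\<close>, is the basic
  Euclidean instanton iff it is gauge equivalent to the trivial bundle with the above potential,
  that is, has a global frame \<open>e\<close> in which this is the connection form. That potential takes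
  values in all quaternions, the Lie algebra of the group of nonzero quaternions. The reduction
  to \<open>Sp(1)\<close> is a gauge transformation \<open>g\<close> in this group to a unitary frame in which the
  connection form takes values in the imaginary quaternions \<open>sp(1)\<close>.
\<close>

definition sp1 :: "(complex^2^2) set" where
  "sp1 = quat ` {y. y $ 1 = 0}"

definition is_basic_euclidean_instanton :: "(real^4) framed_connection \<Rightarrow> bool" where
  "is_basic_euclidean_instanton C \<longleftrightarrow>
     (\<exists>e g \<alpha>.
        C UNIV e euclidean_potential \<and>
        smooth_on UNIV g \<and> (\<forall>x. g x \<in> quaternions \<and> invertible (g x)) \<and>
        C UNIV (\<lambda>x. e x ** g x) \<alpha> \<and>
        (\<forall>x. unitary_frame (e x ** g x)) \<and> (\<forall>x v. \<alpha> x v \<in> sp1))"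


section \<open>The basic split anti-instanton\<close>

definition split_potential :: "real^2^2 \<Rightarrow> real^2^2 \<Rightarrow> real^2^2" where
  "split_potential X V = matrix_inv (mat 1 + transpose X ** X) ** transpose X ** V"

text \<open>
  \<^term>\<open>hom_class\<close> makes the real pairs a principal \<open>GL(2,\<real>)\<close>-bundle over \<^term>\<open>HRP1\<close>,
  and \<open>X \<mapsto> (X, 1)\<close> is a section of it over the split quaternions.
\<close>

definition principal_connection :: "(real hpair \<Rightarrow> real hpair \<Rightarrow> real^2^2) \<Rightarrow> bool" where
  "principal_connection \<omega> \<longleftrightarrow>
     (\<forall>u\<in>hom_pairs. linear (\<omega> u)) \<and>
     (\<forall>v. smooth_on hom_pairs (\<lambda>u. \<omega> u v)) \<and>
     (\<forall>u\<in>hom_pairs. \<forall>B. \<omega> u (hom_act u B) = B) \<and>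
     (\<forall>u\<in>hom_pairs. \<forall>v q. invertible q \<longrightarrow>
        \<omega> (hom_act u q) (hom_act v q) = matrix_inv q ** \<omega> u v ** q)"

text \<open>
  The extension to \<^term>\<open>HRP1\<close> of the connection given on the split quaternions by the above
  potential; it is unique by \<open>split_extension_unique\<close> below.
\<close>

definition split_extension :: "(real hpair \<Rightarrow> real hpair \<Rightarrow> real^2^2) \<Rightarrow> bool" where
  "split_extension \<omega> \<longleftrightarrow>
     principal_connection \<omega> \<and> (\<forall>X V. \<omega> (X, mat 1) (V, 0) = split_potential X V)"

lemma matrix_inv_inverse: fixes A :: "real^2^2" assumes "invertible A"
  shows "A ** matrix_inv A = mat 1" "matrix_inv A ** A = mat 1"
proof -
  have "\<exists>B. A ** B = mat 1 \<and> B ** A = mat 1" using assms by (simp add: invertible_def)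
  then have "A ** matrix_inv A = mat 1 \<and> matrix_inv A ** A = mat 1"
    unfolding matrix_inv_def by (rule someI_ex)
  then show "A ** matrix_inv A = mat 1" "matrix_inv A ** A = mat 1" by auto
qed

lemma split_extension_affine:
  assumes "split_extension \<omega>"
  shows "\<omega> (X, mat 1) (A, B) = B + split_potential X (A - X ** B)"
proof -
  have u: "(X, mat 1) \<in> hom_pairs" by (auto simp: hom_pairs_def)
  have lin: "linear (\<omega> (X, mat 1))" and vert: "\<omega> (X, mat 1) (hom_act (X, mat 1) B) = B"
    and pot: "\<omega> (X, mat 1) (A - X ** B, 0) = split_potential X (A - X ** B)"
    using assms u by (auto simp: split_extension_def principal_connection_def)
  have "(A, B) = hom_act (X, mat 1) B + (A - X ** B, 0)" by (simp add: hom_act_def)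
  then show ?thesis using linear_add[OF lin] vert pot by metis
qed

lemma split_extension_unique:
  assumes 1: "split_extension \<omega>1" and 2: "split_extension \<omega>2" and u: "u \<in> hom_pairs"
  shows "\<omega>1 u v = \<omega>2 u v"
proof -
  have inv: "\<omega>1 w v = \<omega>2 w v" if w: "w \<in> hom_pairs" and iw: "invertible (snd w)" for w
  proof -
    let ?q = "matrix_inv (snd w)"
    have q: "invertible ?q"
      using matrix_inv_inverse[OF iw] invertible_def by blast
    have w1: "hom_act w ?q = (fst w ** ?q, mat 1)"
      by (simp add: hom_act_def matrix_inv_inverse(1) iw)
    have e: "\<omega> (hom_act w ?q) (hom_act v ?q) = matrix_inv ?q ** \<omega> w v ** ?q"
      if "split_extension \<omega>" for \<omega>
      using that w q unfolding split_extension_def principal_connection_def by blast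
    have "\<omega>1 (hom_act w ?q) (hom_act v ?q) = \<omega>2 (hom_act w ?q) (hom_act v ?q)"
      unfolding w1 hom_act_def[of v] by (simp add: split_extension_affine 1 2)
    then have "matrix_inv ?q ** \<omega>1 w v ** ?q = matrix_inv ?q ** \<omega>2 w v ** ?q"
      using e[OF 1] e[OF 2] by simp
    then have "?q ** (matrix_inv ?q ** \<omega>1 w v ** ?q) ** matrix_inv ?q
             = ?q ** (matrix_inv ?q ** \<omega>2 w v ** ?q) ** matrix_inv ?q" by simp
    moreover have "?q ** (matrix_inv ?q ** M ** ?q) ** matrix_inv ?q = M" for M :: "real^2^2"
      by (metis (no_types, lifting) matrix_inv_inverse(1)[OF q] matrix_mul_assoc matrix_mul_lid
          matrix_mul_rid)
    ultimately show ?thesis by simp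
  qed
  define c where "c t = (fst u, snd u + t *\<^sub>R mat 1)" for t :: real
  have c0: "c 0 = u" by (simp add: c_def)
  have cc: "(c \<longlongrightarrow> u) (at 0)"
    unfolding c_def by (rule tendsto_eq_intros refl | simp)+
  have hp: "(Z, W) \<in> hom_pairs \<longleftrightarrow> True" if "invertible W" for Z W :: "real^2^2"
  proof -
    have "Q = 0" if "W ** Q = 0" for Q :: "real^2^2"
    proof -
      have "Q = matrix_inv W ** (W ** Q)"
        by (simp add: matrix_mul_assoc matrix_inv_inverse(2)[OF \<open>invertible W\<close>])
      also have "\<dots> = 0" unfolding that by (simp add: matrix_matrix_mult_def vec_eq_iff)
      finally show ?thesis .
    qed
    then show ?thesis by (auto simp: hom_pairs_def)
  qed
  have ev: "eventually (\<lambda>t. invertible (snd (c t))) (at 0)"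
  proof -
    let ?p = "[: det (snd u), snd u $1$1 + snd u $2$2, 1 :]"
    have d: "det (snd (c t)) = poly ?p t" for t
      by (simp add: c_def det_2 mat_def algebra_simps)
    have "finite {t. poly ?p t = 0}" by (rule poly_roots_finite) simp
    then have "finite ({t. poly ?p t = 0} - {0})" by simp
    from finite_imp_closed[OF this] have "open (- ({t. poly ?p t = 0} - {0}))" by blast
    then have "eventually (\<lambda>t. t \<in> - ({t. poly ?p t = 0} - {0})) (nhds 0)"
      by (rule eventually_nhds_in_open) simp
    then show ?thesis
      unfolding eventually_at_filter by eventually_elim (auto simp: invertible_det_nz d)
  qed
  have ev2: "eventually (\<lambda>t. \<omega>1 (c t) v = \<omega>2 (c t) v) (at 0)"
    using ev by eventually_elim (rule inv, auto simp: hp c_def)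
  have ev3: "eventually (\<lambda>t. c t \<in> hom_pairs) (at 0)"
    using ev by eventually_elim (auto simp: hp c_def)
  have lim: "((\<lambda>t. \<omega> (c t) v) \<longlongrightarrow> \<omega> u v) (at 0)" if "split_extension \<omega>" for \<omega>
  proof -
    have "higher_differentiable_on hom_pairs (\<lambda>u. \<omega> u v) 0"
      using that unfolding split_extension_def principal_connection_def smooth_on_def by blast
    then have "continuous_on hom_pairs (\<lambda>u. \<omega> u v)" by simp
    then show ?thesis by (rule continuous_on_tendsto_compose[OF _ cc u ev3])
  qed
  have "((\<lambda>t. \<omega>2 (c t) v) \<longlongrightarrow> \<omega>1 u v) (at 0)"
    by (rule Lim_transform_eventually[OF lim[OF 1] ev2])
  then show ?thesis by (rule tendsto_unique[OF trivial_limit_at _ lim[OF 2]])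
qed

text \<open>
  \<open>C\<close> is the pullback to the real pairs of a bundle with connection over \<^term>\<open>HRP1\<close>.
  An equivariant frame \<open>e\<close> is an isomorphism onto this bundle from the complex rank two bundle
  associated with the principal bundle, and \<open>\<omega>\<close> is the connection form in this frame iff the
  isomorphism preserves the connections. The reduction to \<open>O(2)\<close> is given by local sections
  \<open>s\<close> of the principal bundle, viewed as functions on saturated sets that are constant on
  classes, for which the frame \<open>e \<circ> s\<close> is unitary and its connection form lies in \<open>o(2)\<close>;
  any two such frames are related by a matrix in \<open>GL(2,\<real>) \<inter> U(2) = O(2)\<close>.
\<close>

definition local_section :: "real hpair set \<Rightarrow> (real hpair \<Rightarrow> real hpair) \<Rightarrow> bool" where
  "local_section N s \<longleftrightarrow>
     open N \<and> N \<subseteq> hom_pairs \<and> smooth_on N s \<and>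
     (\<forall>u\<in>N. s u \<in> hom_class u \<and> (\<forall>q. invertible q \<longrightarrow> hom_act u q \<in> N \<and> s (hom_act u q) = s u))"

definition is_basic_split_anti_instanton :: "(real hpair) framed_connection \<Rightarrow> bool" where
  "is_basic_split_anti_instanton C \<longleftrightarrow>
     (\<exists>\<omega> e.
        split_extension \<omega> \<and>
        C hom_pairs e (\<lambda>u v. cmat (\<omega> u v)) \<and>
        (\<forall>u\<in>hom_pairs. \<forall>q. invertible q \<longrightarrow> e (hom_act u q) = e u ** cmat q) \<and>
        (\<forall>u\<in>hom_pairs. \<exists>N s \<alpha>.
           u \<in> N \<and> local_section N s \<and>
           (\<forall>y\<in>N. unitary_frame (e (s y))) \<and>
           C N (\<lambda>y. e (s y)) (\<lambda>y v. cmat (\<alpha> y v)) \<and>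
           (\<forall>y\<in>N. \<forall>v. transpose (\<alpha> y v) = - \<alpha> y v)))"

end

theory Submission
  imports Defs
begin

text \<open>
  If \<open>f\<close> is a frame of a subbundle of a trivial Hermitian bundle, the projected connection has the
  form \<open>(f\<^sup>* f)\<^sup>-\<^sup>1 f\<^sup>* df\<close> in this frame. For \<open>f = (x, 1)\<close> over the quaternions this is
  \<open>(1 + x\<^sup>* x)\<^sup>-\<^sup>1 x\<^sup>* dx\<close>, where \<open>x\<^sup>*\<close> is the quaternion conjugate, and for \<open>f = (X, 1)\<close> over the
  split quaternions \<open>X\<^sup>*\<close> is the transpose. In homogeneous coordinates \<open>u\<close> the second form is
  \<open>(u\<^sup>t u)\<^sup>-\<^sup>1 u\<^sup>t du\<close>, which is defined on all real pairs and thus gives the extension. In a unitary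
  frame \<open>f\<^sup>* df\<close> is skew-Hermitian because \<open>f\<^sup>* f = 1\<close>; this yields the reductions to \<open>Sp(1)\<close>
  and \<open>O(2)\<close>, the unitary frames being obtained by scaling and by Gram--Schmidt.
\<close>

section \<open>Smooth maps\<close>

text \<open>Since \<open>S\<close> is open, functions that agree on \<open>S\<close> agree near each
  of its points. Their Frechet derivatives there agree too, so the induction passes to the
  derivatives.\<close>

lemma higher_differentiable_on_cong:
  assumes "open S" "higher_differentiable_on S f n" "\<And>x. x \<in> S \<Longrightarrow> g x = f x"
  shows "higher_differentiable_on S g n"
  using assms(2,3)
proof (induction n arbitrary: f g)
  case 0
  then show ?case by (metis continuous_on_cong higher_differentiable_on.simps(1))
next
  case (Suc n)
  have d: "(g has_derivative frechet_derivative f (at x)) (at x)" if "x \<in> S" for x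
  proof (rule has_derivative_transform_within_open[OF _ assms(1) that])
    show "(f has_derivative frechet_derivative f (at x)) (at x)"
      using Suc.prems(1) that by (simp add: frechet_derivative_works[symmetric])
  qed (simp add: Suc.prems(2))
  have "higher_differentiable_on S (\<lambda>x. frechet_derivative g (at x) v) n" for v
  proof (rule Suc.IH)
    show "higher_differentiable_on S (\<lambda>x. frechet_derivative f (at x) v) n"
      using Suc.prems(1) by simp
    show "frechet_derivative g (at x) v = frechet_derivative f (at x) v" if "x \<in> S" for x
      using frechet_derivative_at[OF d[OF that]] by simp
  qed
  then show ?case using d by (auto intro: differentiableI)
qed

text \<open>Allows any explicit formula for the derivative in place of the operator
  \<open>frechet_derivative\<close>. The inductions for sums, products, inverses and roots feed
  their differentiation rules into it.\<close>

lemma higher_differentiable_on_Suc: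
  assumes "open S" "\<And>x. x \<in> S \<Longrightarrow> (f has_derivative f' x) (at x)"
    and "\<And>v. higher_differentiable_on S (\<lambda>x. f' x v) n"
  shows "higher_differentiable_on S f (Suc n)"
proof -
  have "higher_differentiable_on S (\<lambda>x. frechet_derivative f (at x) v) n" for v
    by (rule higher_differentiable_on_cong[OF assms(1) assms(3)])
       (simp add: frechet_derivative_at[OF assms(2), symmetric])
  then show ?thesis using assms(2) by (auto intro: differentiableI)
qed

lemma higher_differentiable_on_SucD:
  assumes "higher_differentiable_on S f (Suc n)"
  shows "x \<in> S \<Longrightarrow> (f has_derivative frechet_derivative f (at x)) (at x)"
    and "higher_differentiable_on S (\<lambda>x. frechet_derivative f (at x) v) n"
  using assms by (auto simp: frechet_derivative_works[symmetric])

text \<open>Differentiation rules also contain the undifferentiated functions, which are then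
  required at order \<open>n\<close> while order \<open>Suc n\<close> is given.\<close>

lemma higher_differentiable_on_lower:
  "higher_differentiable_on S f (Suc n) \<Longrightarrow> higher_differentiable_on S f n"
proof (induction n arbitrary: f)
  case 0
  then show ?case
    by (auto intro!: continuous_at_imp_continuous_on differentiable_imp_continuous_within)
next
  case (Suc n)
  then show ?case by (metis higher_differentiable_on.simps(2))
qed

section \<open>Closure properties of differentiability of finite order\<close>

lemma higher_differentiable_on_const: "open S \<Longrightarrow> higher_differentiable_on S (\<lambda>x. c) n"
proof (induction n arbitrary: c)
  case (Suc n)
  show ?case by (rule higher_differentiable_on_Suc[OF Suc.prems has_derivative_const Suc.IH[OF Suc.prems]])
qed simp

lemma higher_differentiable_on_bounded_linear:
  assumes "bounded_linear L" "open S" "higher_differentiable_on S f n"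
  shows "higher_differentiable_on S (\<lambda>x. L (f x)) n"
  using assms(3)
proof (induction n arbitrary: f)
  case 0
  then show ?case by (auto intro: bounded_linear.continuous_on[OF assms(1)])
next
  case (Suc n)
  note D = higher_differentiable_on_SucD[OF Suc.prems]
  show ?case
    by (rule higher_differentiable_on_Suc[OF assms(2) bounded_linear.has_derivative[OF assms(1) D(1)]
          Suc.IH[OF D(2)]])
qed

lemma higher_differentiable_on_add:
  assumes "open S" "higher_differentiable_on S f n" "higher_differentiable_on S g n"
  shows "higher_differentiable_on S (\<lambda>x. f x + g x) n"
  using assms(2,3)
proof (induction n arbitrary: f g)
  case 0
  then show ?case by (auto intro: continuous_intros)
next
  case (Suc n)
  note F = higher_differentiable_on_SucD[OF Suc.prems(1)]
  note G = higher_differentiable_on_SucD[OF Suc.prems(2)]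
  show ?case
    by (rule higher_differentiable_on_Suc[OF assms(1) has_derivative_add[OF F(1) G(1)]
          Suc.IH[OF F(2) G(2)]])
qed

text \<open>The product rule gives two terms of the same bilinear shape with other factors, so the
  induction runs over all pairs \<open>f\<close>, \<open>g\<close>.\<close>

lemma higher_differentiable_on_bounded_bilinear:
  assumes "bounded_bilinear B" "open S"
    and "higher_differentiable_on S f n" "higher_differentiable_on S g n"
  shows "higher_differentiable_on S (\<lambda>x. B (f x) (g x)) n"
  using assms(3,4)
proof (induction n arbitrary: f g)
  case 0
  then show ?case by (auto intro: bounded_bilinear.continuous_on[OF assms(1)])
next
  case (Suc n)
  note F = higher_differentiable_on_SucD[OF Suc.prems(1)]
  note G = higher_differentiable_on_SucD[OF Suc.prems(2)]
  show ?case
    by (rule higher_differentiable_on_Suc[OF assms(2) bounded_bilinear.FDERIV[OF assms(1) F(1) G(1)]])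
       (auto intro!: higher_differentiable_on_add assms(2) Suc.IH F(2) G(2)
          higher_differentiable_on_lower[OF Suc.prems(1)] higher_differentiable_on_lower[OF Suc.prems(2)])
qed

lemmas higher_differentiable_on_mult =
  higher_differentiable_on_bounded_bilinear[OF bounded_bilinear_mult]

text \<open>The derivative \<open>-(1/f) f' (1/f)\<close> contains \<open>1/f\<close> again, but one
  order lower, where the induction hypothesis covers it.\<close>

lemma higher_differentiable_on_inverse:
  fixes f :: "'a::euclidean_space \<Rightarrow> 'b::real_normed_field"
  assumes "open S" "\<And>x. x \<in> S \<Longrightarrow> f x \<noteq> 0" "higher_differentiable_on S f n"
  shows "higher_differentiable_on S (\<lambda>x. inverse (f x)) n"
  using assms(3)
proof (induction n)
  case 0
  then show ?case using assms(2) by (auto intro: continuous_intros)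
next
  case (Suc n)
  note F = higher_differentiable_on_SucD[OF Suc.prems]
  have i: "higher_differentiable_on S (\<lambda>x. inverse (f x)) n"
    by (rule Suc.IH[OF higher_differentiable_on_lower[OF Suc.prems]])
  show ?case
    by (rule higher_differentiable_on_Suc[OF assms(1) Deriv.has_derivative_inverse[OF assms(2) F(1)]])
       (auto intro!: higher_differentiable_on_mult assms(1) i F(2)
          higher_differentiable_on_bounded_linear[OF bounded_linear_minus[OF bounded_linear_ident]])
qed

text \<open>The derivative is \<open>f' / (2 sqrt f)\<close>. The root has order \<open>n\<close> by
  the induction hypothesis, and its reciprocal by the lemma on inverses.\<close>

lemma higher_differentiable_on_sqrt:
  fixes f :: "'a::euclidean_space \<Rightarrow> real"
  assumes "open S" "\<And>x. x \<in> S \<Longrightarrow> f x > 0" "higher_differentiable_on S f n"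
  shows "higher_differentiable_on S (\<lambda>x. sqrt (f x)) n"
  using assms(3)
proof (induction n)
  case 0
  then show ?case by (auto intro: continuous_intros)
next
  case (Suc n)
  note F = higher_differentiable_on_SucD[OF Suc.prems]
  have i: "higher_differentiable_on S (\<lambda>x. sqrt (f x)) n"
    by (rule Suc.IH[OF higher_differentiable_on_lower[OF Suc.prems]])
  have d: "((\<lambda>x. sqrt (f x)) has_derivative
      (\<lambda>v. frechet_derivative f (at x) v * (inverse (sqrt (f x)) * (1/2)))) (at x)" if "x \<in> S" for x
    using has_derivative_real_sqrt[OF assms(2)[OF that] F(1)[OF that]]
    by (simp add: field_simps)
  have "higher_differentiable_on S (\<lambda>x. inverse (sqrt (f x))) n"
    by (rule higher_differentiable_on_inverse[OF assms(1) _ i]) (use assms(2) in force)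
  then show ?case
    by (intro higher_differentiable_on_Suc[OF assms(1) d] higher_differentiable_on_mult
        higher_differentiable_on_const assms(1) F(2))
qed

lemma higher_differentiable_on_subset:
  "higher_differentiable_on S f n \<Longrightarrow> T \<subseteq> S \<Longrightarrow> higher_differentiable_on T f n"
  by (induction n arbitrary: f) (auto intro: continuous_on_subset)

section \<open>Smooth maps of infinite order\<close>

lemma smooth_on_cong:
  "open S \<Longrightarrow> smooth_on S f \<Longrightarrow> (\<And>x. x \<in> S \<Longrightarrow> g x = f x) \<Longrightarrow> smooth_on S g"
  unfolding smooth_on_def by (blast intro: higher_differentiable_on_cong)

lemma smooth_on_const: "open S \<Longrightarrow> smooth_on S (\<lambda>x. c)"
  unfolding smooth_on_def by (blast intro: higher_differentiable_on_const)

lemma smooth_on_bounded_linear: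
  "bounded_linear L \<Longrightarrow> open S \<Longrightarrow> smooth_on S f \<Longrightarrow> smooth_on S (\<lambda>x. L (f x))"
  unfolding smooth_on_def by (blast intro: higher_differentiable_on_bounded_linear)

lemma smooth_on_linear:
  fixes L :: "'b::euclidean_space \<Rightarrow> 'c::real_normed_vector"
  shows "linear L \<Longrightarrow> open S \<Longrightarrow> smooth_on S f \<Longrightarrow> smooth_on S (\<lambda>x. L (f x))"
  by (simp add: linear_conv_bounded_linear smooth_on_bounded_linear)

lemma smooth_on_ident: "open S \<Longrightarrow> smooth_on S (\<lambda>x. x)"
  unfolding smooth_on_def
proof
  fix n assume S: "open S"
  show "higher_differentiable_on S (\<lambda>x. x) n"
  proof (cases n)
    case (Suc m)
    then show ?thesis
      using higher_differentiable_on_Suc[OF S has_derivative_ident higher_differentiable_on_const[OF S]]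
      by simp
  qed simp
qed

lemma smooth_on_add:
  "open S \<Longrightarrow> smooth_on S f \<Longrightarrow> smooth_on S g \<Longrightarrow> smooth_on S (\<lambda>x. f x + g x)"
  unfolding smooth_on_def by (blast intro: higher_differentiable_on_add)

lemma smooth_on_bounded_bilinear:
  "bounded_bilinear B \<Longrightarrow> open S \<Longrightarrow> smooth_on S f \<Longrightarrow> smooth_on S g \<Longrightarrow>
    smooth_on S (\<lambda>x. B (f x) (g x))"
  unfolding smooth_on_def by (blast intro: higher_differentiable_on_bounded_bilinear)

lemmas smooth_on_mult = smooth_on_bounded_bilinear[OF bounded_bilinear_mult]
lemmas smooth_on_scaleR = smooth_on_bounded_bilinear[OF bounded_bilinear_scaleR]

lemma smooth_on_inverse:
  fixes f :: "'a::euclidean_space \<Rightarrow> 'b::real_normed_field"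
  shows "open S \<Longrightarrow> (\<And>x. x \<in> S \<Longrightarrow> f x \<noteq> 0) \<Longrightarrow> smooth_on S f \<Longrightarrow> smooth_on S (\<lambda>x. inverse (f x))"
  unfolding smooth_on_def by (blast intro: higher_differentiable_on_inverse)

lemma smooth_on_sqrt:
  fixes f :: "'a::euclidean_space \<Rightarrow> real"
  shows "open S \<Longrightarrow> (\<And>x. x \<in> S \<Longrightarrow> f x > 0) \<Longrightarrow> smooth_on S f \<Longrightarrow> smooth_on S (\<lambda>x. sqrt (f x))"
  unfolding smooth_on_def by (blast intro: higher_differentiable_on_sqrt)

lemma smooth_on_subset: "smooth_on S f \<Longrightarrow> T \<subseteq> S \<Longrightarrow> smooth_on T f"
  unfolding smooth_on_def by (blast intro: higher_differentiable_on_subset)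

lemma smooth_on_has_derivative:
  "smooth_on S f \<Longrightarrow> x \<in> S \<Longrightarrow> (f has_derivative frechet_derivative f (at x)) (at x)"
  unfolding smooth_on_def by (meson higher_differentiable_on_SucD(1))

lemma smooth_on_continuous_on: "smooth_on S f \<Longrightarrow> continuous_on S f"
  unfolding smooth_on_def by (meson higher_differentiable_on.simps(1))

lemma has_derivative_linear_image:
  fixes L :: "'b::euclidean_space \<Rightarrow> 'c::real_normed_vector"
  assumes "linear L" "(f has_derivative f') F"
  shows "((\<lambda>x. L (f x)) has_derivative (\<lambda>v. L (f' v))) F"
  using assms by (simp add: linear_conv_bounded_linear bounded_linear.has_derivative)

text \<open>The product rule is compared with the derivative of a constant. Applied to
  \<open>f* f = 1\<close> it gives \<open>f* df + (df)* f = 0\<close>, from which the skewness of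
  both reduced connection forms follows.\<close>

lemma bilinear_constant_derivative:
  assumes B: "bounded_bilinear B" and "open S" "x \<in> S"
    and f: "(f has_derivative f') (at x)" and g: "(g has_derivative g') (at x)"
    and c: "\<And>y. y \<in> S \<Longrightarrow> B (f y) (g y) = c"
  shows "B (f x) (g' v) + B (f' v) (g x) = 0"
proof -
  have "((\<lambda>y. c) has_derivative (\<lambda>v. B (f x) (g' v) + B (f' v) (g x))) (at x)"
    by (rule has_derivative_transform_within_open[OF bounded_bilinear.FDERIV[OF B f g] assms(2,3)])
       (simp add: c)
  from has_derivative_unique[OF this has_derivative_const] show ?thesis by (rule fun_cong)
qed


section \<open>Matrices\<close>

text \<open>\<open>matrix_inv\<close> is defined by choice; two-sided inverses are unique, so
  exhibiting one determines it.\<close>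

lemma matrix_inv_eqI: "A ** B = mat 1 \<Longrightarrow> B ** A = mat 1 \<Longrightarrow> matrix_inv A = B"
  unfolding matrix_inv_def
  by (rule some_equality) (auto, metis matrix_mul_assoc matrix_mul_lid matrix_mul_rid)

lemma matrix_inv_invertible:
  assumes "invertible A"
  shows "A ** matrix_inv A = mat 1" "matrix_inv A ** A = mat 1"
  using assms matrix_inv_eqI unfolding invertible_def by metis+

lemma invertible_matrix_inv: "invertible A \<Longrightarrow> invertible (matrix_inv A)"
  using matrix_inv_invertible invertible_def by metis

lemma matrix_inv_mult:
  assumes "invertible A" "invertible B"
  shows "matrix_inv (A ** B) = matrix_inv B ** matrix_inv A"
  by (rule matrix_inv_eqI) (metis assms matrix_inv_invertible matrix_mul_assoc matrix_mul_lid)+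

lemma matrix_inv_mat_1: "matrix_inv (mat 1 :: 'a::semiring_1^'n^'n) = mat 1"
  by (rule matrix_inv_eqI) simp_all

lemma bounded_bilinear_matrix_mult:
  "bounded_bilinear ((**) :: 'a::{real_normed_field,euclidean_space}^'m^'n \<Rightarrow> 'a^'k^'m \<Rightarrow> 'a^'k^'n)"
  unfolding bilinear_conv_bounded_bilinear[symmetric] bilinear_def
  by (auto intro!: linearI simp: vec_eq_iff matrix_matrix_mult_def algebra_simps sum.distrib
      scaleR_sum_right)

lemmas smooth_on_matrix_mult = smooth_on_bounded_bilinear[OF bounded_bilinear_matrix_mult]

lemma bounded_linear_mat: "bounded_linear (mat :: 'a::{real_normed_field,euclidean_space} \<Rightarrow> 'a^'n^'n)"
  unfolding linear_conv_bounded_linear[symmetric]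
  by (rule linearI) (auto simp: mat_def vec_eq_iff)

section \<open>Inverses of 2-by-2 matrices through the adjugate\<close>

lemma linear_vec_nth2: "linear (\<lambda>A::'a::real_vector^'m^'n. A $ i $ j)"
  by (rule linearI) auto

definition adjugate2 :: "'a::comm_ring_1^2^2 \<Rightarrow> 'a^2^2" where
  "adjugate2 A = vector [vector [A $ 2 $ 2, - A $ 1 $ 2], vector [- A $ 2 $ 1, A $ 1 $ 1]]"

lemma adjugate2_mult:
  "A ** adjugate2 A = mat (det A)" "adjugate2 A ** A = mat (det A)"
  by (simp_all add: adjugate2_def matrix_matrix_mult_def mat_def vec_eq_iff forall_2 sum_2 det_2
      algebra_simps)

lemma mat_matrix_mult: "mat c ** A = (\<chi> i j. c * A $ i $ j)" for A :: "'a::comm_semiring_1^'n^'m"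
  by (simp add: matrix_matrix_mult_def mat_def vec_eq_iff if_distrib [where f="\<lambda>x. x * y" for y]
      cong: if_cong)

lemma matrix_mult_mat: "A ** mat c = (\<chi> i j. c * A $ i $ j)" for A :: "'a::comm_semiring_1^'n^'m"
  by (simp add: matrix_matrix_mult_def mat_def vec_eq_iff if_distrib mult.commute cong: if_cong)

lemma matrix_inv_adjugate2:
  fixes A :: "'a::field^2^2"
  assumes "det A \<noteq> 0"
  shows "matrix_inv A = mat (inverse (det A)) ** adjugate2 A"
proof (rule matrix_inv_eqI)
  have c: "A ** mat c = mat c ** A" for c by (simp add: mat_matrix_mult matrix_mult_mat)
  show "A ** (mat (inverse (det A)) ** adjugate2 A) = mat 1"
    unfolding matrix_mul_assoc c
    unfolding matrix_mul_assoc[symmetric] adjugate2_mult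
    by (simp add: mat_matrix_mult) (simp add: mat_def vec_eq_iff assms)
  show "mat (inverse (det A)) ** adjugate2 A ** A = mat 1"
    unfolding matrix_mul_assoc[symmetric] adjugate2_mult
    by (simp add: mat_matrix_mult) (simp add: mat_def vec_eq_iff assms)
qed

lemma linear_adjugate2: "linear (adjugate2 :: 'a::{real_normed_field,euclidean_space}^2^2 \<Rightarrow> _)"
  by (rule linearI) (simp_all add: adjugate2_def vec_eq_iff forall_2)

lemma smooth_on_det2:
  fixes f :: "'b::euclidean_space \<Rightarrow> 'a::{real_normed_field,euclidean_space}^2^2"
  assumes "open S" "smooth_on S f"
  shows "smooth_on S (\<lambda>x. det (f x))"
proof -
  note nth = smooth_on_linear[OF linear_vec_nth2 assms]
  have "smooth_on S (\<lambda>x. f x $ 1 $ 1 * f x $ 2 $ 2 + - (f x $ 1 $ 2 * f x $ 2 $ 1))"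
    by (intro smooth_on_add smooth_on_mult nth assms
        smooth_on_bounded_linear[OF bounded_linear_minus[OF bounded_linear_ident]])
  then show ?thesis by (simp add: det_2)
qed

text \<open>Cramer's rule: the inverse is the reciprocal of a nowhere vanishing determinant times
  the adjugate, which in size 2 is linear in the entries.\<close>

lemma smooth_on_matrix_inv:
  fixes f :: "'b::euclidean_space \<Rightarrow> 'a::{real_normed_field,euclidean_space}^2^2"
  assumes "open S" "smooth_on S f" "\<And>x. x \<in> S \<Longrightarrow> invertible (f x)"
  shows "smooth_on S (\<lambda>x. matrix_inv (f x))"
proof -
  have nz: "det (f x) \<noteq> 0" if "x \<in> S" for x using assms(3)[OF that] by (simp add: invertible_det_nz)
  have "smooth_on S (\<lambda>x. mat (inverse (det (f x))) ** adjugate2 (f x))"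
    by (intro smooth_on_matrix_mult smooth_on_bounded_linear[OF bounded_linear_mat] smooth_on_inverse
        smooth_on_det2 smooth_on_linear[OF linear_adjugate2] assms nz)
  then show ?thesis
    by (rule smooth_on_cong[OF assms(1)]) (simp add: matrix_inv_adjugate2 nz)
qed

lemma invertible_matrix_mult:
  "invertible A \<Longrightarrow> invertible B \<Longrightarrow> invertible (A ** B)" for A B :: "'a::field^'n^'n"
  by (simp add: invertible_det_nz det_mul)

lemma invertible_ker:
  assumes "invertible A" "A *v c = 0"
  shows "c = 0"
  by (metis assms matrix_inv_invertible(2) matrix_vector_mul_assoc matrix_vector_mul_lid
      matrix_vector_mult_0_right)

lemma column_matrix_mult: "column j (A ** B) = A *v column j B"
  by (simp add: column_def matrix_matrix_mult_def matrix_vector_mult_def vec_eq_iff)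

lemma linear_column: "linear (column j :: 'a::real_vector^'m^'n \<Rightarrow> _)"
  by (rule linearI) (auto simp: column_def vec_eq_iff)

lemma vector_4:
  "(vector [a, b, c, d] :: 'a::zero^4) $ 1 = a"
  "(vector [a, b, c, d] :: 'a::zero^4) $ 2 = b"
  "(vector [a, b, c, d] :: 'a::zero^4) $ 3 = c"
  "(vector [a, b, c, d] :: 'a::zero^4) $ 4 = d"
  by (simp_all add: vector_def)

section \<open>Gram matrices and Hermitian orthogonal projection\<close>

definition hadj :: "complex^'n^'m \<Rightarrow> complex^'m^'n" where
  "hadj A = (\<chi> i j. cnj (A $ j $ i))"

lemma hadj_mult: "hadj (A ** B) = hadj B ** hadj A"
  by (simp add: hadj_def matrix_matrix_mult_def vec_eq_iff mult.commute)

lemma hadj_mat_1: "hadj (mat 1) = mat 1"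
  by (simp add: hadj_def mat_def vec_eq_iff)

lemma invertible_hadj: "invertible A \<Longrightarrow> invertible (hadj A)"
  unfolding invertible_def by (metis hadj_mult hadj_mat_1)

lemma herm_hadj: "herm (A *v c) y = herm c (hadj A *v y)"
proof -
  have "herm (A *v c) y = (\<Sum>i\<in>UNIV. \<Sum>j\<in>UNIV. cnj (c $ j) * (cnj (A $ i $ j) * y $ i))"
    by (simp add: herm_def matrix_vector_mult_def sum_distrib_right mult.assoc mult.left_commute)
  also have "\<dots> = herm c (hadj A *v y)"
    by (subst sum.swap) (simp add: herm_def hadj_def matrix_vector_mult_def sum_distrib_left)
  finally show ?thesis .
qed

lemma herm_self_eq_0: "herm x x = 0 \<longleftrightarrow> x = 0"
proof
  assume "herm x x = 0"
  moreover have "herm x x = of_real (\<Sum>i\<in>UNIV. (cmod (x $ i))\<^sup>2)"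
    by (simp add: herm_def complex_norm_square mult.commute del: of_real_power)
  ultimately have "(\<Sum>i\<in>UNIV. (cmod (x $ i))\<^sup>2) = 0" by (metis of_real_eq_0_iff)
  then show "x = 0" by (simp add: sum_nonneg_eq_0_iff vec_eq_iff)
qed (simp add: herm_def)

text \<open>If \<open>f* f c = 0\<close>, then \<open>f c\<close> has Hermitian square zero, so
  \<open>f c = 0\<close> and \<open>c = 0\<close>. A square matrix with trivial kernel is
  invertible.\<close>

lemma invertible_gram:
  fixes f :: "complex^'n^'m"
  assumes "\<And>c. f *v c = 0 \<Longrightarrow> c = 0"
  shows "invertible (hadj f ** f)"
proof -
  have "c = 0" if "(hadj f ** f) *v c = 0" for c
  proof -
    have "herm (f *v c) (f *v c) = herm c 0"
      using that by (simp add: herm_hadj matrix_vector_mul_assoc)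
    then show ?thesis using assms by (simp add: herm_def[of c] herm_self_eq_0)
  qed
  then show ?thesis by (simp add: invertible_left_inverse matrix_left_invertible_ker)
qed

text \<open>For injective \<open>f\<close> this is the Moore-Penrose left inverse, and
  \<open>f ** pinv f\<close> is the orthogonal projection onto the column span of
  \<open>f\<close>.\<close>

definition pinv :: "complex^'n^'m \<Rightarrow> complex^'m^'n" where
  "pinv f = matrix_inv (hadj f ** f) ** hadj f"

text \<open>The Gram matrix of \<open>f ** g\<close> is \<open>g* (f* f) g\<close>, and the inverse
  of its left factor \<open>g*\<close> cancels against the \<open>g*\<close> in
  \<open>(f ** g)*\<close>. This is the source of the gauge transformation rule.\<close>

lemma pinv_mult:
  fixes f :: "complex^'n^'m" and g :: "complex^'n^'n"
  assumes "invertible (hadj f ** f)" "invertible g"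
  shows "pinv (f ** g) = matrix_inv g ** pinv f"
proof -
  let ?G = "hadj f ** f"
  have e: "hadj (f ** g) ** (f ** g) = hadj g ** (?G ** g)"
    by (simp add: hadj_mult matrix_mul_assoc)
  have "matrix_inv (hadj g ** (?G ** g)) = matrix_inv (?G ** g) ** matrix_inv (hadj g)"
    using assms by (intro matrix_inv_mult invertible_matrix_mult invertible_hadj)
  then have "pinv (f ** g) = matrix_inv (?G ** g) ** matrix_inv (hadj g) ** (hadj g ** hadj f)"
    unfolding pinv_def e by (simp only: hadj_mult)
  also have "\<dots> = matrix_inv (?G ** g) ** (matrix_inv (hadj g) ** hadj g) ** hadj f"
    by (simp only: matrix_mul_assoc)
  also have "\<dots> = matrix_inv g ** pinv f"
    using assms by (simp add: pinv_def matrix_inv_invertible(2) invertible_hadj matrix_inv_mult matrix_mul_assoc)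
  finally show ?thesis .
qed

lemma pinv_self: "invertible (hadj f ** f) \<Longrightarrow> pinv f ** f = mat 1"
  by (simp add: pinv_def matrix_mul_assoc[symmetric] matrix_inv_invertible)

lemma herm_proj_range:
  assumes "invertible (hadj f ** f)"
  shows "herm_proj (range (\<lambda>c. f *v c)) y = f *v (pinv f *v y)"
  unfolding herm_proj_def
proof (rule the_equality)
  \<comment> \<open>The normal equations: they say that the residual of \<open>y\<close> is
    orthogonal to every column of \<open>f\<close>.\<close>
  have n: "hadj f *v (f *v (pinv f *v y)) = hadj f *v y"
    using matrix_inv_invertible(1)[OF assms]
    by (simp add: matrix_vector_mul_assoc pinv_def matrix_mul_assoc)
  then show p: "f *v (pinv f *v y) \<in> range (\<lambda>c. f *v c) \<and>
      (\<forall>w\<in>range (\<lambda>c. f *v c). herm w (y - f *v (pinv f *v y)) = 0)"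
    by (auto simp: herm_hadj matrix_vector_mult_diff_distrib) (simp add: herm_def)
  fix z assume z: "z \<in> range (\<lambda>c. f *v c) \<and> (\<forall>w\<in>range (\<lambda>c. f *v c). herm w (y - z) = 0)"
  then obtain c where c: "z = f *v c" by auto
  have d: "f *v (pinv f *v y) - z = f *v (pinv f *v y - c)"
    by (simp add: c matrix_vector_mult_diff_distrib)
  \<comment> \<open>Both candidates have residuals orthogonal to the range, so their difference,
    itself in the range, is orthogonal to itself.\<close>
  have "herm w (f *v (pinv f *v y) - z) = 0" if "w \<in> range (\<lambda>c. f *v c)" for w
  proof -
    have "herm w (y - z) = 0" "herm w (y - f *v (pinv f *v y)) = 0" using z p that by blast+
    then show ?thesis by (simp add: herm_def algebra_simps sum_subtractf)
  qed
  then have "f *v (pinv f *v y) - z = 0" using d herm_self_eq_0 by (metis rangeI)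
  then show "z = f *v (pinv f *v y)" by simp
qed

lemma linear_hadj: "linear hadj"
  by (rule linearI) (simp_all add: hadj_def vec_eq_iff)

lemma unitary_frame_iff: "unitary_frame f \<longleftrightarrow> hadj f ** f = mat 1"
  by (simp add: unitary_frame_def herm_def column_def hadj_def matrix_matrix_mult_def mat_def vec_eq_iff)

lemma pinv_unitary: "hadj f ** f = mat 1 \<Longrightarrow> pinv f = hadj f"
  by (simp add: pinv_def matrix_inv_mat_1)


section \<open>Homogeneous pairs\<close>

lemma stack_nth [simp]:
  "stack u $ 1 = fst u $ 1" "stack u $ 2 = fst u $ 2" "stack u $ 3 = snd u $ 1" "stack u $ 4 = snd u $ 2"
  by (simp_all add: stack_def vector_4)

lemma linear_stack: "linear (stack :: 'a::{real_normed_field,euclidean_space} hpair \<Rightarrow> _)"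
  by (rule linearI) (simp_all add: vec_eq_iff forall_4)

lemma stack_hom_act: "stack (hom_act u q) = stack u ** q"
  by (simp add: vec_eq_iff forall_4 hom_act_def matrix_matrix_mult_def)

lemma stack_eq_0_iff: "stack u = 0 \<longleftrightarrow> fst u = 0 \<and> snd u = 0"
  unfolding vec_eq_iff[of "stack u"] vec_eq_iff[of "fst u"] vec_eq_iff[of "snd u"] by (simp add: forall_4 forall_2)

lemma stack_mult_eq_0_iff:
  "stack u ** Q = 0 \<longleftrightarrow> fst u ** Q = 0 \<and> snd u ** Q = 0" for Q :: "'a::field^2^2"
  using stack_eq_0_iff[of "hom_act u Q"] by (simp add: stack_hom_act) (simp add: hom_act_def)

lemma hadj_stack_mult: "hadj (stack u) ** stack v = hadj (fst u) ** fst v + hadj (snd u) ** snd v"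
  by (simp add: vec_eq_iff hadj_def matrix_matrix_mult_def sum_4 sum_2 add.assoc)

lemma bounded_bilinear_hom_act:
  "bounded_bilinear (hom_act :: 'a::{real_normed_field,euclidean_space} hpair \<Rightarrow> _)"
  unfolding bilinear_conv_bounded_bilinear[symmetric] bilinear_def hom_act_def
  by (auto intro!: linearI simp: vec_eq_iff matrix_matrix_mult_def algebra_simps sum.distrib
      scaleR_sum_right)

lemmas smooth_on_hom_act = smooth_on_bounded_bilinear[OF bounded_bilinear_hom_act]

lemma hom_act_act: "hom_act (hom_act u q) r = hom_act u (q ** r)"
  by (simp add: hom_act_def matrix_mul_assoc)

lemma hom_act_mat_1 [simp]: "hom_act u (mat 1) = u"
  by (simp add: hom_act_def)

text \<open>Turns the condition on 2-by-2 matrices \<open>Q\<close> into injectivity of the 4-by-2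
  matrix. A vector \<open>c\<close> in the kernel gives the \<open>Q\<close> whose columns all equal
  \<open>c\<close>; conversely, the columns of an annihilated \<open>Q\<close> lie in the
  kernel.\<close>

lemma hom_pairs_iff:
  fixes u :: "'a::field hpair"
  shows "u \<in> hom_pairs \<longleftrightarrow> (\<forall>c. stack u *v c = 0 \<longrightarrow> c = 0)"
proof -
  have h: "u \<in> hom_pairs \<longleftrightarrow> (\<forall>Q::'a^2^2. stack u ** Q = 0 \<longrightarrow> Q = 0)"
    by (cases u) (auto simp: hom_pairs_def stack_mult_eq_0_iff)
  show ?thesis unfolding h
  proof (intro iffI allI impI)
    fix c assume Q: "\<forall>Q::'a^2^2. stack u ** Q = 0 \<longrightarrow> Q = 0" and c: "stack u *v c = 0"
    have "stack u ** (\<chi> i j. c $ i) = 0"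
      using c by (simp add: vec_eq_iff matrix_matrix_mult_def matrix_vector_mult_def)
    then have "(\<chi> i j. c $ i) = (0 :: 'a^2^2)" using Q by blast
    then show "c = 0" by (simp add: vec_eq_iff)
  next
    fix Q :: "'a^2^2"
    assume c: "\<forall>c. stack u *v c = 0 \<longrightarrow> c = 0" and Q: "stack u ** Q = 0"
    have "stack u *v column j Q = 0" for j
      using Q by (simp add: column_matrix_mult[symmetric]) (simp add: column_def vec_eq_iff)
    then have "column j Q = 0" for j using c by blast
    then show "Q = 0" by (simp add: column_def vec_eq_iff)
  qed
qed

lemma hom_pairsI: "invertible (P ** stack u) \<Longrightarrow> u \<in> hom_pairs"
  unfolding hom_pairs_iff
proof safe
  fix c assume i: "invertible (P ** stack u)" and "stack u *v c = 0"
  from this(2) have "(P ** stack u) *v c = 0" by (simp add: matrix_vector_mul_assoc[symmetric])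
  then show "c = 0" by (rule invertible_ker[OF i])
qed

text \<open>The choice \<open>P = hadj (stack u)\<close> makes \<open>P ** stack u\<close>
  invertible for every admissible \<open>u\<close>; hence the charts introduced below cover
  everything.\<close>

lemma hom_pairs_gram: "u \<in> hom_pairs \<longleftrightarrow> invertible (hadj (stack u) ** stack u)"
  using hom_pairsI[of "hadj (stack u)" u] invertible_gram[of "stack u"] hom_pairs_iff[of u] by blast

lemma hom_act_hom_pairs:
  assumes "u \<in> hom_pairs" "invertible q"
  shows "hom_act u q \<in> hom_pairs"
  unfolding hom_pairs_iff stack_hom_act
proof safe
  fix c assume "(stack u ** q) *v c = 0"
  then have "q *v c = 0" using assms(1) by (simp add: hom_pairs_iff matrix_vector_mul_assoc[symmetric])
  then show "c = 0" by (rule invertible_ker[OF assms(2)])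
qed

section \<open>Classes of pairs and frames in affine charts\<close>

lemma hom_class_eq: "u \<in> hom_pairs \<Longrightarrow> hom_class u = {hom_act u q | q. invertible q}"
  by (auto simp: hom_class_def hom_rel_def intro: hom_act_hom_pairs)

lemma hom_class_self: "u \<in> hom_pairs \<Longrightarrow> u \<in> hom_class u"
  by (auto simp: hom_class_eq invertible_def intro!: exI[of _ "mat 1"])

lemma hom_class_act:
  assumes "u \<in> hom_pairs" "invertible q"
  shows "hom_class (hom_act u q) = hom_class u"
proof -
  have "\<exists>r'. hom_act u r = hom_act (hom_act u q) r' \<and> invertible r'" if "invertible r" for r
    by (rule exI[of _ "matrix_inv q ** r"])
       (simp add: hom_act_act matrix_mul_assoc assms matrix_inv_invertible that invertible_matrix_mult invertible_matrix_inv)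
  then show ?thesis
    using assms invertible_matrix_mult
    by (auto simp: hom_class_eq hom_act_hom_pairs) (auto simp: hom_act_act)
qed

lemma universal_bundle_hom_class:
  assumes "u \<in> hom_pairs"
  shows "universal_bundle (hom_class u) = range (\<lambda>c. stack u *v c)"
  using hom_class_self[OF assms]
  by (auto simp: universal_bundle_def hom_class_eq[OF assms] stack_hom_act matrix_vector_mul_assoc[symmetric])

text \<open>The affine chart of the Grassmannian given by \<open>P\<close>: on planes that
  \<open>P\<close> maps isomorphically, this is the unique basis matrix \<open>f\<close> with
  \<open>P ** f = mat 1\<close>. The normalization makes the choice of a representative
  harmless.\<close>

definition normalized_frame :: "'a::field^4^2 \<Rightarrow> 'a hpair set \<Rightarrow> 'a^2^4" where
  "normalized_frame P p = (let u = SOME u. u \<in> p in stack u ** matrix_inv (P ** stack u))"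

text \<open>Passing from \<open>u\<close> to \<open>hom_act u q\<close> multiplies the stack by
  \<open>q\<close> on the right and the inverse by \<open>matrix_inv q\<close> on the left, and
  these cancel.\<close>

lemma normalized_frame_hom_class:
  assumes "invertible (P ** stack u)"
  shows "normalized_frame P (hom_class u) = stack u ** matrix_inv (P ** stack u)"
proof -
  note u = hom_pairsI[OF assms]
  have "(SOME w. w \<in> hom_class u) \<in> hom_class u" using hom_class_self[OF u] by (rule someI)
  then obtain q where q: "invertible q" "(SOME w. w \<in> hom_class u) = hom_act u q"
    using hom_class_eq[OF u] by auto
  show ?thesis
    unfolding normalized_frame_def Let_def q(2) stack_hom_act
    using matrix_inv_mult[OF assms q(1)] matrix_inv_invertible(1)[OF q(1)]
    by (metis matrix_mul_assoc matrix_mul_rid)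
qed

definition frame_domain :: "'a::field^4^2 \<Rightarrow> 'a hpair set" where
  "frame_domain P = {u. invertible (P ** stack u)}"

lemma frame_domain_act:
  assumes "u \<in> frame_domain P" "invertible q"
  shows "hom_act u q \<in> frame_domain P"
  using assms invertible_matrix_mult[OF _ assms(2)]
  by (simp add: frame_domain_def stack_hom_act matrix_mul_assoc)

lemma frame_domain_subset: "frame_domain P \<subseteq> hom_pairs"
  by (auto simp: frame_domain_def intro: hom_pairsI)

lemma smooth_on_stack_mult:
  fixes P :: "'a::{real_normed_field,euclidean_space}^4^2"
  assumes "open S" "smooth_on S f"
  shows "smooth_on S (\<lambda>x. P ** stack (f x))"
  by (intro smooth_on_matrix_mult smooth_on_const smooth_on_linear[OF linear_stack] assms)

lemma open_frame_domain:
  fixes P :: "'a::{real_normed_field,euclidean_space}^4^2"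
  shows "open (frame_domain P)"
proof -
  have "continuous_on UNIV (\<lambda>u. det (P ** stack u))"
    by (intro smooth_on_continuous_on smooth_on_det2 smooth_on_stack_mult smooth_on_ident open_UNIV)
  then have "open ((\<lambda>u. det (P ** stack u)) -` (- {0}))"
    by (intro open_vimage) auto
  then show ?thesis by (simp add: frame_domain_def invertible_det_nz vimage_def)
qed

lemma smooth_on_normalized_frame:
  fixes P :: "'a::{real_normed_field,euclidean_space}^4^2"
  shows "smooth_on (frame_domain P) (\<lambda>u. normalized_frame P (hom_class u))"
proof -
  note o = open_frame_domain[of P]
  have "smooth_on (frame_domain P) (\<lambda>u. stack u ** matrix_inv (P ** stack u))"
    by (intro smooth_on_matrix_mult smooth_on_matrix_inv smooth_on_stack_mult
        smooth_on_linear[OF linear_stack] smooth_on_ident o) (simp add: frame_domain_def)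
  then show ?thesis
    by (rule smooth_on_cong[OF o]) (simp add: frame_domain_def normalized_frame_hom_class)
qed


section \<open>Restrictions of the universal bundle\<close>

lemma hom_class_HCP1: "u \<in> hom_pairs \<Longrightarrow> hom_class u \<in> HCP1"
  unfolding HCP1_def hom_class_def by (rule quotientI)

text \<open>\<open>frame_domain P\<close> is invariant under the right action, so going to classes
  and back adds no pairs. Openness and smoothness over the chart can thus be checked on
  \<open>frame_domain P\<close>.\<close>

lemma hcp1_preimage_frame_domain: "hcp1_preimage (hom_class ` frame_domain P) = frame_domain P"
proof (intro equalityI subsetI)
  fix u assume "u \<in> hcp1_preimage (hom_class ` frame_domain P)"
  then obtain w where u: "u \<in> hom_pairs" and w: "w \<in> frame_domain P" "hom_class u = hom_class w"
    by (auto simp: hcp1_preimage_def)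
  then have "u \<in> hom_class w" using hom_class_self by metis
  moreover have "w \<in> hom_pairs" using w frame_domain_subset by blast
  ultimately show "u \<in> frame_domain P" using w(1) by (auto simp: hom_class_eq frame_domain_act)
next
  fix u assume "u \<in> frame_domain P"
  then show "u \<in> hcp1_preimage (hom_class ` frame_domain P)"
    using frame_domain_subset by (auto simp: hcp1_preimage_def)
qed

lemma is_basis_matrix_stack:
  assumes "u \<in> hom_pairs"
  shows "is_basis_matrix (stack u) (universal_bundle (hom_class u))"
proof -
  have "c = d" if "stack u *v c = stack u *v d" for c d
  proof -
    have "stack u *v (c - d) = 0" using that by (simp add: matrix_vector_mult_diff_distrib)
    then have "c - d = 0" using assms hom_pairs_iff by blast
    then show ?thesis by simp
  qed
  then show ?thesis
    by (simp add: is_basis_matrix_def inj_def universal_bundle_hom_class[OF assms])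
qed

text \<open>The normalized frame at a class is the stack of another representative of that class,
  hence a basis of the fibre.\<close>

lemma local_frame_normalized_frame:
  "local_frame universal_bundle (hom_class ` frame_domain P) (normalized_frame P)"
proof -
  have "is_basis_matrix (normalized_frame P (hom_class u)) (universal_bundle (hom_class u))"
    if u: "u \<in> frame_domain P" for u
  proof -
    have i: "invertible (P ** stack u)" using u by (simp add: frame_domain_def)
    note h = hom_pairsI[OF i] and i' = invertible_matrix_inv[OF i]
    have "normalized_frame P (hom_class u) = stack (hom_act u (matrix_inv (P ** stack u)))"
      by (simp add: normalized_frame_hom_class[OF i] stack_hom_act)
    then show ?thesis
      using is_basis_matrix_stack[OF hom_act_hom_pairs[OF h i']] hom_class_act[OF h i'] by simp
  qed
  moreover have "hcp1_open (hom_class ` frame_domain P)"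
    using frame_domain_subset[of P]
    by (auto simp: hcp1_open_def hcp1_preimage_frame_domain open_frame_domain intro!: hom_class_HCP1)
  ultimately show ?thesis
    by (simp add: local_frame_def hcp1_preimage_frame_domain smooth_on_normalized_frame)
qed

section \<open>Connection forms of the projected connection\<close>

lemma invertible_gram_basis:
  assumes "is_basis_matrix f V"
  shows "invertible (hadj f ** f)"
proof (rule invertible_gram)
  fix c assume "f *v c = 0"
  then have "f *v c = f *v 0" by simp
  then show "c = 0" using assms unfolding is_basis_matrix_def by (blast dest: injD)
qed

text \<open>The trivial connection differentiates the columns of \<open>\<sigma>\<close>, and
  projecting applies \<open>\<sigma> ** pinv \<sigma>\<close>. The coefficients with respect to
  \<open>\<sigma>\<close> are therefore \<open>pinv \<sigma> ** d\<sigma>\<close>.\<close>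

lemma frame_connection_form_pinv:
  assumes "local_frame E \<Omega> \<sigma>"
  shows "frame_connection_form (projected_connection E) \<Omega> \<sigma>
    (\<lambda>u v. pinv (\<sigma> (hom_class u)) ** frechet_derivative (\<lambda>u. \<sigma> (hom_class u)) (at u) v)"
  unfolding frame_connection_form_def
proof (intro ballI allI)
  fix u v and j :: 2
  assume u: "u \<in> hcp1_preimage \<Omega>"
  let ?f = "\<sigma> (hom_class u)" and ?D = "frechet_derivative (\<lambda>u. \<sigma> (hom_class u)) (at u)"
  have b: "is_basis_matrix ?f (E (hom_class u))"
    using assms u by (auto simp: local_frame_def hcp1_preimage_def)
  have r: "E (hom_class u) = range (\<lambda>c. ?f *v c)" using b by (simp add: is_basis_matrix_def)
  have "((\<lambda>u. \<sigma> (hom_class u)) has_derivative ?D) (at u)"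
    using assms u by (auto simp: local_frame_def intro: smooth_on_has_derivative)
  then have "((\<lambda>u. column j (\<sigma> (hom_class u))) has_derivative (\<lambda>v. column j (?D v))) (at u)"
    by (rule has_derivative_linear_image[OF linear_column])
  then have "trivial_connection (\<lambda>p. column j (\<sigma> p)) u v = column j (?D v)"
    unfolding trivial_connection_def by (metis frechet_derivative_at)
  then show "projected_connection E (\<lambda>p. column j (\<sigma> p)) u v = ?f *v column j (pinv ?f ** ?D v)"
    by (simp add: projected_connection_def r herm_proj_range[OF invertible_gram_basis[OF b]]
        column_matrix_mult)
qed

text \<open>The content is that \<open>(f\<^sup>* f)\<^sup>-\<^sup>1 f\<^sup>* df\<close> obeys the gauge transformation rule.\<close>

lemma restricted_connection_lift:
  assumes S: "open S" and \<Phi>: "smooth_on S \<Phi>"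
    and lift: "\<And>y. y \<in> S \<Longrightarrow> \<Phi> y \<in> hom_pairs \<and> hom_class (\<Phi> y) = \<phi> y"
    and \<alpha>: "\<And>y v. y \<in> S \<Longrightarrow> \<alpha> y v = pinv (stack (\<Phi> y)) ** stack (frechet_derivative \<Phi> (at y) v)"
  shows "restricted_connection universal_bundle (projected_connection universal_bundle) \<phi> S
    (\<lambda>y. stack (\<Phi> y)) \<alpha>"
  unfolding restricted_connection_def
proof (intro conjI ballI)
  show "open S" by fact
  show "smooth_on S (\<lambda>y. stack (\<Phi> y))"
    by (rule smooth_on_linear[OF linear_stack S \<Phi>])
  show "is_basis_matrix (stack (\<Phi> x)) (universal_bundle (\<phi> x))" if "x \<in> S" for x
    using is_basis_matrix_stack[of "\<Phi> x"] lift[OF that] by simp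
  fix x assume x: "x \<in> S"
  \<comment> \<open>With this \<open>P\<close> the matrix \<open>P ** stack (\<Phi> x)\<close> is
    the Gram matrix at \<open>x\<close>, so the chart contains the image of
    \<open>x\<close>.\<close>
  define P where "P = hadj (stack (\<Phi> x))"
  define N where "N = {y \<in> S. \<Phi> y \<in> frame_domain P}"
  define \<sigma> where "\<sigma> = normalized_frame P"
  define \<Omega> where "\<Omega> = hom_class ` frame_domain P"
  define \<theta> where "\<theta> u v = pinv (\<sigma> (hom_class u)) ** frechet_derivative (\<lambda>u. \<sigma> (hom_class u)) (at u) v"
    for u v
  \<comment> \<open>The only possible gauge factor: multiplying
    \<open>stack (\<Phi> y) = \<sigma> (\<phi> y) ** g y\<close> by \<open>P\<close> and using the
    normalization of \<open>\<sigma>\<close> leaves \<open>g y\<close>.\<close>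
  define g where "g y = P ** stack (\<Phi> y)" for y
  have N: "open N"
  proof -
    have "open (\<Phi> -` frame_domain P \<inter> S)"
      using smooth_on_continuous_on[OF \<Phi>] S open_frame_domain continuous_on_open_vimage by blast
    then show ?thesis by (simp add: N_def vimage_def Int_def conj_commute)
  qed
  have NS: "N \<subseteq> S" by (auto simp: N_def)
  have "x \<in> N"
    using x lift[OF x] by (simp add: N_def frame_domain_def P_def hom_pairs_gram)
  have gauge: "invertible (g y) \<and> stack (\<Phi> y) = \<sigma> (\<phi> y) ** g y \<and>
      (\<forall>v. \<alpha> y v = matrix_inv (g y) ** \<theta> (\<Phi> y) (frechet_derivative \<Phi> (at y) v) ** g y
           + matrix_inv (g y) ** frechet_derivative g (at y) v)" if y: "y \<in> N" for y
  proof (intro conjI allI)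
    have yS: "y \<in> S" using y NS by blast
    have ig: "invertible (P ** stack (\<Phi> z))" if "z \<in> N" for z
      using that by (simp add: N_def frame_domain_def)
    show i: "invertible (g y)" using ig[OF y] by (simp add: g_def)
    \<comment> \<open>Shown on all of \<open>N\<close> and not only at \<open>y\<close>, since both
      sides are differentiated below.\<close>
    have f: "stack (\<Phi> z) = \<sigma> (hom_class (\<Phi> z)) ** g z" if "z \<in> N" for z
      using ig[OF that]
      by (simp add: \<sigma>_def g_def normalized_frame_hom_class matrix_mul_assoc[symmetric] matrix_inv_invertible)
    then show "stack (\<Phi> y) = \<sigma> (\<phi> y) ** g y" using lift[OF yS] y by simp
    fix v
    let ?\<Phi>' = "frechet_derivative \<Phi> (at y)" and ?\<sigma> = "\<sigma> (hom_class (\<Phi> y))"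
    let ?\<sigma>' = "frechet_derivative (\<lambda>u. \<sigma> (hom_class u)) (at (\<Phi> y))"
    have d\<Phi>: "(\<Phi> has_derivative ?\<Phi>') (at y)" by (rule smooth_on_has_derivative[OF \<Phi> yS])
    have dst: "((\<lambda>y. stack (\<Phi> y)) has_derivative (\<lambda>v. stack (?\<Phi>' v))) (at y)"
      by (rule has_derivative_linear_image[OF linear_stack d\<Phi>])
    have dg: "(g has_derivative (\<lambda>v. P ** stack (?\<Phi>' v))) (at y)"
      unfolding g_def
      by (rule bounded_linear.has_derivative[OF
            bounded_bilinear.bounded_linear_right[OF bounded_bilinear_matrix_mult] dst])
    have "((\<lambda>u. \<sigma> (hom_class u)) has_derivative ?\<sigma>') (at (\<Phi> y))"
      using smooth_on_has_derivative[OF smooth_on_normalized_frame[of P], of "\<Phi> y"] y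
      by (simp add: \<sigma>_def N_def)
    from has_derivative_compose[OF d\<Phi> this]
    have d\<sigma>: "((\<lambda>z. \<sigma> (hom_class (\<Phi> z))) has_derivative (\<lambda>v. ?\<sigma>' (?\<Phi>' v))) (at y)" .
    have "((\<lambda>z. stack (\<Phi> z)) has_derivative
        (\<lambda>v. ?\<sigma> ** (P ** stack (?\<Phi>' v)) + ?\<sigma>' (?\<Phi>' v) ** g y)) (at y)"
      by (rule has_derivative_transform_within_open[OF
            bounded_bilinear.FDERIV[OF bounded_bilinear_matrix_mult d\<sigma> dg] N y])
         (simp add: f)
    \<comment> \<open>Two derivatives of the same frame are compared: the direct one, and the
      product rule for \<open>\<sigma> ** g\<close>.\<close>
    from has_derivative_unique[OF dst this]
    have split: "stack (?\<Phi>' v) = ?\<sigma> ** (P ** stack (?\<Phi>' v)) + ?\<sigma>' (?\<Phi>' v) ** g y"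
      by (rule fun_cong)
    have "is_basis_matrix ?\<sigma> (universal_bundle (hom_class (\<Phi> y)))"
      using local_frame_normalized_frame[of P] y by (auto simp: local_frame_def \<sigma>_def N_def)
    note gram = invertible_gram_basis[OF this]
    \<comment> \<open>Now \<open>pinv (\<sigma> ** g) = g^-1 ** pinv \<sigma>\<close> is applied to
      the split derivative. As \<open>pinv \<sigma> ** \<sigma> = mat 1\<close>, one summand becomes
      \<open>g^-1 dg\<close> and the other \<open>g^-1 \<theta> g\<close>.\<close>
    have "\<alpha> y v = matrix_inv (g y) ** pinv ?\<sigma> ** stack (?\<Phi>' v)"
      using pinv_mult[OF gram i] f[OF y] \<alpha>[OF yS] by simp
    also have "\<dots> = matrix_inv (g y) ** pinv ?\<sigma> **
        (?\<sigma> ** (P ** stack (?\<Phi>' v)) + ?\<sigma>' (?\<Phi>' v) ** g y)"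
      by (subst split) (rule refl)
    also have "\<dots> = matrix_inv (g y) ** (pinv ?\<sigma> ** ?\<sigma>) ** (P ** stack (?\<Phi>' v))
        + matrix_inv (g y) ** (pinv ?\<sigma> ** ?\<sigma>' (?\<Phi>' v)) ** g y"
      by (simp add: matrix_add_ldistrib matrix_mul_assoc)
    also have "\<dots> = matrix_inv (g y) ** \<theta> (\<Phi> y) (?\<Phi>' v) ** g y
        + matrix_inv (g y) ** frechet_derivative g (at y) v"
      by (simp add: pinv_self[OF gram] \<theta>_def frechet_derivative_at[OF dg, symmetric] add.commute)
    finally show "\<alpha> y v = \<dots>" .
  qed
  have "local_frame universal_bundle \<Omega> \<sigma>"
    unfolding \<Omega>_def \<sigma>_def by (rule local_frame_normalized_frame)
  moreover from this have "frame_connection_form (projected_connection universal_bundle) \<Omega> \<sigma> \<theta>"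
    unfolding \<theta>_def by (rule frame_connection_form_pinv)
  moreover have "smooth_on N g"
    unfolding g_def by (rule smooth_on_stack_mult[OF N smooth_on_subset[OF \<Phi> NS]])
  moreover have "\<forall>y\<in>N. \<phi> y \<in> \<Omega>" using lift by (force simp: N_def \<Omega>_def)
  ultimately show "\<exists>N \<Psi> \<Omega> \<sigma> \<theta> g.
      open N \<and> x \<in> N \<and> N \<subseteq> S \<and>
      smooth_on N \<Psi> \<and> (\<forall>y\<in>N. \<Psi> y \<in> hom_pairs \<and> hom_class (\<Psi> y) = \<phi> y) \<and>
      (\<forall>y\<in>N. \<phi> y \<in> \<Omega>) \<and> local_frame universal_bundle \<Omega> \<sigma> \<and>
      frame_connection_form (projected_connection universal_bundle) \<Omega> \<sigma> \<theta> \<and> smooth_on N g \<and>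
      (\<forall>y\<in>N. invertible (g y) \<and> stack (\<Phi> y) = \<sigma> (\<phi> y) ** g y \<and>
        (\<forall>v. \<alpha> y v = matrix_inv (g y) ** \<theta> (\<Psi> y) (frechet_derivative \<Psi> (at y) v) ** g y
           + matrix_inv (g y) ** frechet_derivative g (at y) v))"
    using N \<open>x \<in> N\<close> NS smooth_on_subset[OF \<Phi> NS] lift gauge
    by (intro exI[of _ N] exI[of _ \<Phi>] exI[of _ \<Omega>] exI[of _ \<sigma>] exI[of _ \<theta>] exI[of _ g]) blast
qed


section \<open>The Euclidean instanton\<close>

lemma linear_quat: "linear quat"
  by (rule linearI) (simp_all add: quat_def vec_eq_iff forall_2 complex_eq_iff)

lemma hadj_quat: "hadj (quat x) = quat (qconj x)"
  by (simp add: hadj_def quat_def qconj_def vec_eq_iff forall_2 vector_4 complex_eq_iff)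

lemma quat_qconj_mult: "quat (qconj x) ** quat x = mat (of_real (x \<bullet> x))"
  by (simp add: quat_def qconj_def vec_eq_iff forall_2 vector_4 complex_eq_iff mat_def
      matrix_matrix_mult_def sum_2 inner_vec_def sum_4 algebra_simps)

lemma quat_quaternions: "quat x \<in> quaternions"
  using range_quat by blast

lemma mat_of_real_quaternions: "mat (of_real r) \<in> quaternions"
  by (simp add: quaternions_def mat_def)

lemma quaternions_add: "A \<in> quaternions \<Longrightarrow> B \<in> quaternions \<Longrightarrow> A + B \<in> quaternions"
  by (simp add: quaternions_def)

lemma quaternions_mult: "A \<in> quaternions \<Longrightarrow> B \<in> quaternions \<Longrightarrow> A ** B \<in> quaternions"
  by (simp add: quaternions_def matrix_matrix_mult_def sum_2)

lemma quaternions_hadj: "A \<in> quaternions \<Longrightarrow> hadj A \<in> quaternions"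
  by (simp add: quaternions_def hadj_def)

text \<open>A skew-Hermitian matrix has imaginary diagonal entries, and the scalar part of a
  quaternion is the real part of its upper left entry.\<close>

lemma sp1I:
  assumes "A \<in> quaternions" "hadj A = - A"
  shows "A \<in> sp1"
proof -
  obtain y where y: "A = quat y" using assms(1) range_quat by blast
  have "hadj A $ 1 $ 1 = - A $ 1 $ 1" using assms(2) by simp
  then have "y $ 1 = 0" by (simp add: y hadj_def quat_def complex_eq_iff)
  then show ?thesis by (auto simp: sp1_def y)
qed

section \<open>The affine frame over the quaternions and its unitary rescaling\<close>

lemma hom_pairs_affine: "(Z, mat 1) \<in> hom_pairs"
  by (auto simp: hom_pairs_def)

lemma linear_fst_embed: "linear (\<lambda>A::'a::real_vector. (A, 0::'b::real_vector))"
  by (rule linearI) auto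

lemma smooth_on_affine_quat: "smooth_on UNIV (\<lambda>x. (quat x, mat 1 :: complex^2^2))"
proof -
  have "smooth_on UNIV (\<lambda>x. (quat x, 0) + (0, mat 1 :: complex^2^2))"
    by (intro smooth_on_add smooth_on_const smooth_on_linear[OF linear_fst_embed]
        smooth_on_linear[OF linear_quat] smooth_on_ident open_UNIV)
  then show ?thesis by simp
qed

lemma has_derivative_affine_quat:
  "((\<lambda>x. (quat x, mat 1 :: complex^2^2)) has_derivative (\<lambda>v. (quat v, 0))) (at x)"
  by (intro has_derivative_Pair has_derivative_const has_derivative_linear_image[OF linear_quat]
      has_derivative_ident)

text \<open>The Gram matrix of the frame \<open>(x, 1)\<close> is the scalar
  \<open>1 + |x|^2\<close>, because the conjugate of \<open>x\<close> times \<open>x\<close> is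
  \<open>|x|^2\<close>. Multiplication by this positive real number therefore makes the frame
  unitary.\<close>

abbreviation unitary_scale :: "real^4 \<Rightarrow> real" where
  "unitary_scale x \<equiv> inverse (sqrt (1 + x \<bullet> x))"

lemma smooth_on_unitary_scale: "smooth_on UNIV unitary_scale"
proof -
  have pos: "1 + x \<bullet> x > 0" for x :: "real^4" by (simp add: add_pos_nonneg)
  show ?thesis
    by (intro smooth_on_inverse smooth_on_sqrt smooth_on_add smooth_on_const
        smooth_on_bounded_bilinear[OF bounded_bilinear_inner] smooth_on_ident open_UNIV pos)
       (metis pos less_irrefl real_sqrt_gt_zero)
qed

lemma linear_mat_of_real: "linear (\<lambda>r. mat (complex_of_real r) :: complex^2^2)"
  by (intro bounded_linear.linear bounded_linear_compose[OF bounded_linear_mat bounded_linear_of_real])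

lemma is_basic_euclidean_instanton_universal_bundle:
  "is_basic_euclidean_instanton
     (restricted_connection universal_bundle (projected_connection universal_bundle)
        (\<lambda>x. hc_embed (quat x)))"
proof -
  let ?C = "restricted_connection universal_bundle (projected_connection universal_bundle)
      (\<lambda>x. hc_embed (quat x))"
  define \<Phi> where "\<Phi> x = (quat x, mat 1 :: complex^2^2)" for x
  define g :: "real^4 \<Rightarrow> complex^2^2" where "g x = mat (of_real (unitary_scale x))" for x
  \<comment> \<open>The rescaled frame is the stack of another lift of the same map, so
    \<open>restricted_connection_lift\<close> gives its connection form directly.\<close>
  define \<Psi> where "\<Psi> x = hom_act (\<Phi> x) (g x)" for x
  define \<alpha> where "\<alpha> x v = pinv (stack (\<Psi> x)) ** stack (frechet_derivative \<Psi> (at x) v)" for x v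
  have s\<Phi>: "smooth_on UNIV \<Phi>" unfolding \<Phi>_def by (rule smooth_on_affine_quat)
  have d\<Phi>: "(\<Phi> has_derivative (\<lambda>v. (quat v, 0))) (at x)" for x
    unfolding \<Phi>_def by (rule has_derivative_affine_quat)
  have h\<Phi>: "\<Phi> x \<in> hom_pairs" for x by (simp add: \<Phi>_def hom_pairs_affine)
  have gram: "hadj (stack (\<Phi> x)) ** stack (\<Phi> x) = mat 1 + quat (qconj x) ** quat x" for x
    by (simp add: hadj_stack_mult \<Phi>_def hadj_quat hadj_mat_1 add.commute)
  have 1: "?C UNIV (\<lambda>x. stack (\<Phi> x)) euclidean_potential"
  proof (rule restricted_connection_lift[OF open_UNIV s\<Phi>])
    show "\<Phi> y \<in> hom_pairs \<and> hom_class (\<Phi> y) = hc_embed (quat y)" for y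
      using h\<Phi> by (simp add: hc_embed_def \<Phi>_def)
    show "euclidean_potential y v = pinv (stack (\<Phi> y)) ** stack (frechet_derivative \<Phi> (at y) v)" for y v
      unfolding pinv_def gram
      unfolding matrix_mul_assoc[symmetric] hadj_stack_mult
        frechet_derivative_at[OF d\<Phi>, symmetric]
      by (simp add: euclidean_potential_def \<Phi>_def hadj_quat matrix_mul_assoc)
  qed
  have sg: "smooth_on UNIV g"
    unfolding g_def
    by (intro smooth_on_linear[OF linear_mat_of_real] smooth_on_unitary_scale open_UNIV)
  have ig: "invertible (g x)" for x
  proof -
    have "sqrt (1 + x \<bullet> x) \<noteq> 0" by (metis add_pos_nonneg inner_ge_zero less_irrefl real_sqrt_gt_zero zero_less_one)
    then show ?thesis by (simp add: invertible_det_nz g_def det_2 mat_def)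
  qed
  have s\<Psi>: "smooth_on UNIV \<Psi>" unfolding \<Psi>_def by (intro smooth_on_hom_act s\<Phi> sg open_UNIV)
  have e\<Psi>: "stack (\<Psi> x) = stack (\<Phi> x) ** g x" for x by (simp add: \<Psi>_def stack_hom_act)
  have 2: "?C UNIV (\<lambda>x. stack (\<Phi> x) ** g x) \<alpha>"
    unfolding e\<Psi>[symmetric]
  proof (rule restricted_connection_lift[OF open_UNIV s\<Psi>])
    show "\<Psi> y \<in> hom_pairs \<and> hom_class (\<Psi> y) = hc_embed (quat y)" for y
      using hom_act_hom_pairs[OF h\<Phi> ig] hom_class_act[OF h\<Phi> ig]
      by (simp add: hc_embed_def \<Psi>_def) (simp add: \<Phi>_def)
  qed (simp add: \<alpha>_def)
  have unit: "hadj (stack (\<Psi> x)) ** stack (\<Psi> x) = mat 1" for x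
  proof -
    have "1 + x \<bullet> x > 0" by (simp add: add_pos_nonneg)
    then have r: "unitary_scale x * ((1 + x \<bullet> x) * unitary_scale x) = 1"
      by (simp add: field_simps)
    have "hadj (stack (\<Psi> x)) ** stack (\<Psi> x) = hadj (g x) ** ((hadj (stack (\<Phi> x)) ** stack (\<Phi> x)) ** g x)"
      by (simp add: e\<Psi> hadj_mult matrix_mul_assoc)
    also have "\<dots> = mat (of_real (unitary_scale x * ((1 + x \<bullet> x) * unitary_scale x)))"
      unfolding gram quat_qconj_mult g_def
      by (simp add: vec_eq_iff forall_2 matrix_matrix_mult_def sum_2 hadj_def mat_def)
    finally show ?thesis by (simp only: r of_real_1)
  qed
  have \<alpha>: "\<alpha> x v \<in> sp1" for x v
  proof (rule sp1I)
    let ?\<rho>' = "frechet_derivative unitary_scale (at x)"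
    have dg: "(g has_derivative (\<lambda>v. mat (of_real (?\<rho>' v)))) (at x)"
      unfolding g_def
      by (rule has_derivative_linear_image[OF linear_mat_of_real
            smooth_on_has_derivative[OF smooth_on_unitary_scale UNIV_I]])
    \<comment> \<open>The explicit derivative shows that all blocks of \<open>\<Psi>\<close> and
      \<open>d\<Psi>\<close> are quaternions; so is the form, being a sum of products of them and
      their adjoints.\<close>
    have "(\<Psi> has_derivative (\<lambda>v. hom_act (\<Phi> x) (mat (of_real (?\<rho>' v))) + hom_act (quat v, 0) (g x))) (at x)"
      unfolding \<Psi>_def by (rule bounded_bilinear.FDERIV[OF bounded_bilinear_hom_act d\<Phi> dg])
    note d\<Psi> = frechet_derivative_at[OF this, symmetric]
    have a: "\<alpha> x v = hadj (stack (\<Psi> x)) ** stack (frechet_derivative \<Psi> (at x) v)"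
      by (simp add: \<alpha>_def pinv_unitary[OF unit])
    show "\<alpha> x v \<in> quaternions"
      unfolding a d\<Psi> hadj_stack_mult
      using mat_of_real_quaternions[of 1]
      by (auto simp: \<Psi>_def \<Phi>_def g_def hom_act_def simp del: of_real_inverse intro!: quaternions_add quaternions_mult
          quaternions_hadj quat_quaternions mat_of_real_quaternions)
    have d: "((\<lambda>x. stack (\<Psi> x)) has_derivative (\<lambda>v. stack (frechet_derivative \<Psi> (at x) v))) (at x)"
      by (rule has_derivative_linear_image[OF linear_stack smooth_on_has_derivative[OF s\<Psi> UNIV_I]])
    \<comment> \<open>Differentiating the unitarity relation makes the form skew-Hermitian.\<close>
    have "hadj (stack (\<Psi> x)) ** stack (frechet_derivative \<Psi> (at x) v)
        + hadj (stack (frechet_derivative \<Psi> (at x) v)) ** stack (\<Psi> x) = 0"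
      by (rule bilinear_constant_derivative[OF bounded_bilinear_matrix_mult open_UNIV UNIV_I
            has_derivative_linear_image[OF linear_hadj d] d unit])
    moreover have "hadj (\<alpha> x v) = hadj (stack (frechet_derivative \<Psi> (at x) v)) ** stack (\<Psi> x)"
      unfolding a hadj_mult by (simp add: hadj_def)
    ultimately show "hadj (\<alpha> x v) = - \<alpha> x v" by (simp add: a add_eq_0_iff)
  qed
  have q: "\<forall>x. g x \<in> quaternions \<and> invertible (g x)"
    using ig by (simp add: g_def mat_of_real_quaternions del: of_real_inverse)
  have u: "\<forall>x. unitary_frame (stack (\<Phi> x) ** g x)"
    using unit by (simp add: unitary_frame_iff e\<Psi>)
  show ?thesis
    unfolding is_basic_euclidean_instanton_def
    using 1 sg q 2 u \<alpha>
    by (intro exI[of _ "\<lambda>x. stack (\<Phi> x)"] exI[of _ g] exI[of _ \<alpha>]) blast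
qed


section \<open>The split anti-instanton\<close>

abbreviation complexify :: "real^'n^'m \<Rightarrow> complex^'n^'m" where
  "complexify \<equiv> map_matrix complex_of_real"

lemma complexify_mult: "complexify (A ** B) = complexify A ** complexify B"
  by (simp add: vec_eq_iff matrix_matrix_mult_def)

lemma complexify_mat_1: "complexify (mat 1) = mat 1"
  by (simp add: vec_eq_iff mat_def)

lemma complexify_invertible:
  fixes A :: "real^'n^'n"
  assumes "invertible A"
  shows "invertible (complexify A)" "matrix_inv (complexify A) = complexify (matrix_inv A)"
proof -
  have "complexify A ** complexify (matrix_inv A) = mat 1" "complexify (matrix_inv A) ** complexify A = mat 1"
    by (simp_all add: complexify_mult[symmetric] matrix_inv_invertible[OF assms] complexify_mat_1)
  then show "invertible (complexify A)" "matrix_inv (complexify A) = complexify (matrix_inv A)"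
    by (auto simp: invertible_def intro: matrix_inv_eqI)
qed

lemma hadj_complexify: "hadj (complexify A) = complexify (transpose A)"
  by (simp add: vec_eq_iff hadj_def transpose_def)

definition complexify_pair :: "real hpair \<Rightarrow> complex hpair" where
  "complexify_pair u = (cmat (fst u), cmat (snd u))"

lemma linear_complexify_pair: "linear complexify_pair"
  by (rule linearI) (auto simp: complexify_pair_def cmat_def vec_eq_iff complex_eq_iff)

lemma stack_complexify_pair: "stack (complexify_pair u) = complexify (stack u)"
  by (simp add: vec_eq_iff forall_4 complexify_pair_def cmat_def)

lemma complexify_pair_hom_act: "complexify_pair (hom_act u q) = hom_act (complexify_pair u) (cmat q)"
  by (simp add: complexify_pair_def hom_act_def cmat_def complexify_mult)

lemma bilinear_gram:
  "bounded_bilinear (\<lambda>u v. transpose (stack u) ** stack v :: real^2^2)"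
  unfolding bilinear_conv_bounded_bilinear[symmetric] bilinear_def
  by (auto intro!: linearI simp: vec_eq_iff matrix_matrix_mult_def transpose_def sum_4 algebra_simps)

lemma transpose_stack_mult:
  "transpose (stack u) ** stack v = transpose (fst u) ** fst v + transpose (snd u) ** snd v"
  by (simp add: vec_eq_iff transpose_def matrix_matrix_mult_def sum_4 sum_2 add.assoc)

text \<open>The real counterpart of \<open>hom_pairs_gram\<close>: the squared length of
  \<open>stack u *v c\<close> is the value of the Gram form at \<open>c\<close>.\<close>

lemma hom_pairs_real_gram:
  fixes u :: "real hpair"
  shows "u \<in> hom_pairs \<longleftrightarrow> invertible (transpose (stack u) ** stack u)"
proof
  assume u: "u \<in> hom_pairs"
  have "c = 0" if "(transpose (stack u) ** stack u) *v c = 0" for c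
  proof -
    have "(stack u *v c) \<bullet> (stack u *v c) = c \<bullet> ((transpose (stack u) ** stack u) *v c)"
      by (metis dot_lmul_matrix matrix_vector_mul_assoc vector_transpose_matrix)
    then have "stack u *v c = 0" using that by simp
    then show ?thesis using u hom_pairs_iff by blast
  qed
  then show "invertible (transpose (stack u) ** stack u)"
    by (simp add: invertible_left_inverse matrix_left_invertible_ker)
qed (rule hom_pairsI)

text \<open>Injectivity over the reals passes to the complex numbers through the Gram matrix, whose
  invertibility survives complexification.\<close>

lemma complexify_pair_hom_pairs:
  assumes "u \<in> hom_pairs"
  shows "complexify_pair u \<in> hom_pairs"
  using complexify_invertible(1)[OF assms[unfolded hom_pairs_real_gram]]
  by (simp add: hom_pairs_gram stack_complexify_pair hadj_complexify complexify_mult)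

text \<open>Real representatives of one class differ by a real invertible \<open>q\<close>, whose
  complexification is invertible; so the union in \<open>hrp1_embed\<close> is over equal
  classes.\<close>

lemma hrp1_embed_hom_class:
  assumes "u \<in> hom_pairs"
  shows "hrp1_embed (hom_class u) = hom_class (complexify_pair u)"
proof -
  have "hom_class (complexify_pair w) = hom_class (complexify_pair u)" if w: "w \<in> hom_class u" for w
  proof -
    obtain q where q: "invertible q" "w = hom_act u q" using w assms by (auto simp: hom_class_eq)
    show ?thesis
      using hom_class_act[OF complexify_pair_hom_pairs[OF assms] complexify_invertible(1)[OF q(1)]]
      by (simp add: q complexify_pair_hom_act cmat_def)
  qed
  then show ?thesis
    unfolding hrp1_embed_def complexify_pair_def[symmetric]
    using hom_class_self[OF assms] by blast
qed

text \<open>Each real pair \<open>u\<close> lies in the open chart domain of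
  \<open>P = transpose (stack u)\<close>.\<close>

lemma open_hom_pairs_real: "open (hom_pairs :: real hpair set)"
proof -
  have "u \<in> frame_domain (transpose (stack u))" if "u \<in> hom_pairs" for u :: "real hpair"
    using that by (simp add: frame_domain_def hom_pairs_real_gram)
  then have e: "hom_pairs = (\<Union>P. frame_domain P :: real hpair set)" using frame_domain_subset by blast
  show ?thesis unfolding e by (intro open_UN ballI open_frame_domain)
qed

section \<open>The real connection form in homogeneous coordinates\<close>

lemma has_derivative_complexify_pair:
  assumes "(s has_derivative s') F"
  shows "((\<lambda>u. complexify_pair (s u)) has_derivative (\<lambda>v. complexify_pair (s' v))) F"
  by (rule has_derivative_linear_image[OF linear_complexify_pair assms])

text \<open>The least-squares coefficient of \<open>v\<close> along the orbit directions
  \<open>hom_act u B\<close>; its kernel at \<open>u\<close> is their orthogonal complement in the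
  space of pairs.\<close>

definition split_connection :: "real hpair \<Rightarrow> real hpair \<Rightarrow> real^2^2" where
  "split_connection u v = matrix_inv (transpose (stack u) ** stack u) ** (transpose (stack u) ** stack v)"

lemma split_connection_complexify:
  assumes "u \<in> hom_pairs"
  shows "pinv (stack (complexify_pair u)) ** stack (complexify_pair v) = complexify (split_connection u v)"
  using complexify_invertible(2)[OF assms[unfolded hom_pairs_real_gram]]
  by (simp add: pinv_def split_connection_def stack_complexify_pair hadj_complexify
      complexify_mult matrix_mul_assoc)

text \<open>On orbit directions the Gram matrix cancels its inverse. Under right translation the
  factors \<open>transpose q\<close> cancel as in \<open>pinv_mult\<close>, leaving conjugation by
  \<open>q\<close>. At \<open>(X, 1)\<close> the Gram matrix is
  \<open>1 + transpose X ** X\<close>.\<close>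

lemma split_extension_split_connection: "split_extension split_connection"
  unfolding split_extension_def principal_connection_def
proof (intro conjI ballI allI impI)
  fix u :: "real hpair" assume u: "u \<in> hom_pairs"
  let ?G = "transpose (stack u) ** stack u"
  have G: "invertible ?G" using u by (simp add: hom_pairs_real_gram)
  show "linear (split_connection u)"
    unfolding split_connection_def
    by (intro bounded_linear.linear bounded_linear_compose[OF
          bounded_bilinear.bounded_linear_right[OF bounded_bilinear_matrix_mult]
          bounded_bilinear.bounded_linear_right[OF bilinear_gram]])
  show "split_connection u (hom_act u B) = B" for B
  proof -
    have "split_connection u (hom_act u B) = (matrix_inv ?G ** ?G) ** B"
      by (simp add: split_connection_def stack_hom_act matrix_mul_assoc)
    then show ?thesis by (simp add: matrix_inv_invertible(2)[OF G])
  qed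
  fix v and q :: "real^2^2" assume q: "invertible q"
  let ?H = "transpose (stack u) ** stack v"
  have t: "invertible (transpose q)" using q by (rule transpose_invertible)
  have "transpose (stack (hom_act u q)) ** stack (hom_act u q) = transpose q ** (?G ** q)"
    by (simp add: stack_hom_act matrix_transpose_mul matrix_mul_assoc)
  moreover have "matrix_inv (transpose q ** (?G ** q)) = matrix_inv (?G ** q) ** matrix_inv (transpose q)"
    by (intro matrix_inv_mult invertible_matrix_mult G q t)
  moreover have "transpose (stack (hom_act u q)) ** stack (hom_act v q) = transpose q ** (?H ** q)"
    by (simp add: stack_hom_act matrix_transpose_mul matrix_mul_assoc)
  ultimately have "split_connection (hom_act u q) (hom_act v q) =
      matrix_inv (?G ** q) ** matrix_inv (transpose q) ** (transpose q ** (?H ** q))"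
    by (simp only: split_connection_def)
  also have "\<dots> = matrix_inv (?G ** q) ** (matrix_inv (transpose q) ** transpose q) ** (?H ** q)"
    by (simp only: matrix_mul_assoc)
  also have "\<dots> = matrix_inv q ** split_connection u v ** q"
    by (simp add: matrix_inv_invertible(2)[OF t] matrix_inv_mult[OF G q] split_connection_def matrix_mul_assoc)
  finally show "split_connection (hom_act u q) (hom_act v q) = matrix_inv q ** split_connection u v ** q" .
next
  fix v :: "real hpair"
  show "smooth_on hom_pairs (\<lambda>u. split_connection u v)"
    unfolding split_connection_def
    by (intro smooth_on_matrix_mult smooth_on_matrix_inv smooth_on_bounded_bilinear[OF bilinear_gram]
        smooth_on_ident smooth_on_const open_hom_pairs_real) (simp add: hom_pairs_real_gram)
next
  fix X V :: "real^2^2"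
  show "split_connection (X, mat 1) (V, 0) = split_potential X V"
    by (simp add: split_connection_def split_potential_def transpose_stack_mult transpose_mat
        add.commute matrix_mul_assoc)
qed

section \<open>Local orthonormal sections of the real pairs\<close>

text \<open>Gram--Schmidt: the columns of \<open>f ** gram_schmidt (transpose f ** f)\<close> are orthonormal.\<close>

definition gram_schmidt :: "real^2^2 \<Rightarrow> real^2^2" where
  "gram_schmidt G =
     inverse (sqrt (G $ 1 $ 1)) *\<^sub>R vector [vector [1, 0], vector [0, 0]]
   + inverse (sqrt (G $ 1 $ 1) * sqrt (det G)) *\<^sub>R vector [vector [0, - G $ 1 $ 2], vector [0, G $ 1 $ 1]]"

text \<open>For the inner product \<open>G\<close>, the vector \<open>(- G12, G11)\<close> is
  orthogonal to the first basis vector and has squared length \<open>G11 * det G\<close>, which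
  explains the two scalings.\<close>

lemma gram_schmidt_orthonormal:
  assumes sym: "G $ 2 $ 1 = G $ 1 $ 2" and a: "G $ 1 $ 1 > 0" and d: "det G > 0"
  shows "transpose (gram_schmidt G) ** G ** gram_schmidt G = mat 1"
proof -
  define p where "p = inverse (sqrt (G $ 1 $ 1))"
  define q where "q = inverse (sqrt (G $ 1 $ 1) * sqrt (det G))"
  have p: "p * p * G $ 1 $ 1 = 1" using a by (simp add: p_def field_simps)
  \<comment> \<open>Stated for arbitrary nonzero \<open>r\<close> and \<open>t\<close>, so that the
    cancellation is purely algebraic; the square roots are substituted afterwards.\<close>
  have "q * q * (r * r) * (t * t) = 1" if "r \<noteq> 0" "t \<noteq> 0" "q = inverse (r * t)" for r t
    using that(1,2) unfolding that(3) by (simp add: field_simps)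
  from this[OF _ _ q_def] have q: "q * q * G $ 1 $ 1 * (G $ 1 $ 1 * G $ 2 $ 2 - G $ 1 $ 2 * G $ 1 $ 2) = 1"
    using a d by (simp add: det_2 sym)
  have T: "gram_schmidt G $ 1 $ 1 = p" "gram_schmidt G $ 1 $ 2 = - q * G $ 1 $ 2"
    "gram_schmidt G $ 2 $ 1 = 0" "gram_schmidt G $ 2 $ 2 = q * G $ 1 $ 1"
    by (simp_all add: gram_schmidt_def p_def q_def)
  show ?thesis
    using p q
    by (simp add: vec_eq_iff forall_2 matrix_matrix_mult_def sum_2 transpose_def mat_def T sym algebra_simps)
qed

lemma smooth_on_gram_schmidt:
  assumes "open S" "smooth_on S f"
    and "\<And>x. x \<in> S \<Longrightarrow> f x $ 1 $ 1 > 0" "\<And>x. x \<in> S \<Longrightarrow> det (f x) > 0"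
  shows "smooth_on S (\<lambda>x. gram_schmidt (f x))"
proof -
  have l: "linear (\<lambda>G::real^2^2. vector [vector [0, - G $ 1 $ 2], vector [0, G $ 1 $ 1]] :: real^2^2)"
    by (rule linearI) (simp_all add: vec_eq_iff forall_2)
  have "sqrt (f x $ 1 $ 1) \<noteq> 0" "sqrt (f x $ 1 $ 1) * sqrt (det (f x)) \<noteq> 0" if "x \<in> S" for x
    using assms(3,4)[OF that] by auto
  then show ?thesis
    unfolding gram_schmidt_def
    by (intro smooth_on_add smooth_on_scaleR smooth_on_inverse smooth_on_mult smooth_on_sqrt
        smooth_on_linear[OF linear_vec_nth2] smooth_on_linear[OF l] smooth_on_det2 smooth_on_const assms)
qed

text \<open>The entries are inner products of columns, so Cauchy-Schwarz makes the determinant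
  nonnegative and invertibility makes it positive. A zero first column would make it vanish.\<close>

lemma real_gram_positive:
  fixes f :: "real^2^'n"
  assumes "invertible (transpose f ** f)"
  shows "(transpose f ** f) $ 1 $ 1 > 0" "det (transpose f ** f) > 0"
    "(transpose f ** f) $ 2 $ 1 = (transpose f ** f) $ 1 $ 2"
proof -
  have G: "(transpose f ** f) $ i $ j = column i f \<bullet> column j f" for i j
    by (simp add: matrix_matrix_mult_def transpose_def column_def inner_vec_def)
  show "(transpose f ** f) $ 2 $ 1 = (transpose f ** f) $ 1 $ 2" by (simp add: G inner_commute)
  have nz: "det (transpose f ** f) \<noteq> 0" using assms by (simp add: invertible_det_nz)
  have "column 1 f \<noteq> 0"
  proof
    assume "column 1 f = 0"
    then have "det (transpose f ** f) = 0" by (simp add: det_2 G)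
    then show False using nz by simp
  qed
  then show "(transpose f ** f) $ 1 $ 1 > 0" by (simp add: G)
  have "det (transpose f ** f) \<ge> 0"
    using Cauchy_Schwarz_ineq[of "column 1 f" "column 2 f"]
    by (simp add: det_2 G inner_commute power2_eq_square)
  then show "det (transpose f ** f) > 0" using nz by simp
qed

text \<open>Gram-Schmidt applied to \<open>y\<close> itself depends on the representative. It is
  therefore applied to the chart-normalized representative \<open>w y\<close>, which depends only on
  the class, and so does the result.\<close>

lemma split_local_reduction:
  fixes u :: "real hpair"
  assumes u: "u \<in> hom_pairs"
  shows "\<exists>N s. u \<in> N \<and> local_section N s \<and> (\<forall>y\<in>N. transpose (stack (s y)) ** stack (s y) = mat 1)"
proof -
  define P where "P = transpose (stack u)"
  define w where "w y = hom_act y (matrix_inv (P ** stack y))" for y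
  define G where "G y = transpose (stack (w y)) ** stack (w y)" for y
  define s where "s y = hom_act (w y) (gram_schmidt (G y))" for y
  let ?N = "frame_domain P"
  note o = open_frame_domain[of P]
  have i: "invertible (P ** stack y)" and h: "y \<in> hom_pairs" and wh: "w y \<in> hom_pairs" if "y \<in> ?N" for y
  proof -
    show i: "invertible (P ** stack y)" using that by (simp add: frame_domain_def)
    show h: "y \<in> hom_pairs" by (rule hom_pairsI[OF i])
    show "w y \<in> hom_pairs"
      unfolding w_def by (rule hom_act_hom_pairs[OF h invertible_matrix_inv[OF i]])
  qed
  have pos: "G y $ 1 $ 1 > 0" "det (G y) > 0" "G y $ 2 $ 1 = G y $ 1 $ 2" if "y \<in> ?N" for y
    using real_gram_positive[of "stack (w y)"] wh[OF that]
    by (auto simp: G_def hom_pairs_real_gram)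
  have one: "transpose (stack (s y)) ** stack (s y) = mat 1" if "y \<in> ?N" for y
    using gram_schmidt_orthonormal[OF pos(3,1,2)[OF that]]
    by (simp add: s_def stack_hom_act matrix_transpose_mul G_def matrix_mul_assoc)
  have sm: "smooth_on ?N w"
    unfolding w_def
    by (intro smooth_on_hom_act smooth_on_matrix_inv smooth_on_stack_mult smooth_on_ident o i)
  have "smooth_on ?N s"
    unfolding s_def
    by (intro smooth_on_hom_act smooth_on_gram_schmidt o sm pos)
       (auto simp: G_def intro!: smooth_on_bounded_bilinear[OF bilinear_gram] o sm)
  moreover have "s y \<in> hom_class y" if y: "y \<in> ?N" for y
  proof -
    have "(transpose (gram_schmidt (G y)) ** G y) ** gram_schmidt (G y) = mat 1"
      by (rule gram_schmidt_orthonormal[OF pos(3,1,2)[OF y]])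
    then have "invertible (gram_schmidt (G y))" using invertible_left_inverse by blast
    then have "invertible (matrix_inv (P ** stack y) ** gram_schmidt (G y))"
      by (intro invertible_matrix_mult invertible_matrix_inv i y)
    then show ?thesis by (auto simp: hom_class_eq[OF h[OF y]] s_def w_def hom_act_act)
  qed
  moreover have "s (hom_act y q) = s y" if y: "y \<in> ?N" and q: "invertible q" for y q
  proof -
    \<comment> \<open>The factor \<open>q\<close> cancels against the inverse; this is the
      invariance of \<open>w\<close>, inherited by \<open>G\<close> and \<open>s\<close>.\<close>
    have "q ** matrix_inv (P ** stack y ** q) = matrix_inv (P ** stack y)"
      by (simp add: matrix_inv_mult[OF i[OF y] q] matrix_mul_assoc matrix_inv_invertible(1)[OF q])
    then have "w (hom_act y q) = w y"
      by (simp add: w_def hom_act_act stack_hom_act matrix_mul_assoc)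
    then show ?thesis by (simp add: s_def G_def)
  qed
  ultimately have "local_section ?N s"
    unfolding local_section_def using o frame_domain_subset[of P] frame_domain_act[of _ P] by blast
  moreover have "u \<in> ?N" using u by (simp add: frame_domain_def P_def hom_pairs_real_gram)
  ultimately show ?thesis using one by blast
qed

lemma is_basic_split_anti_instanton_universal_bundle:
  "is_basic_split_anti_instanton
     (restricted_connection universal_bundle (projected_connection universal_bundle)
        (\<lambda>u. hrp1_embed (hom_class u)))"
proof -
  let ?C = "restricted_connection universal_bundle (projected_connection universal_bundle)
      (\<lambda>u. hrp1_embed (hom_class u))"
  define e where "e u = stack (complexify_pair u)" for u
  have 1: "?C hom_pairs e (\<lambda>u v. cmat (split_connection u v))"
    unfolding e_def
  proof (rule restricted_connection_lift[OF open_hom_pairs_real])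
    show "smooth_on hom_pairs complexify_pair"
      by (intro smooth_on_linear[OF linear_complexify_pair] smooth_on_ident open_hom_pairs_real)
    show "complexify_pair y \<in> hom_pairs \<and> hom_class (complexify_pair y) = hrp1_embed (hom_class y)"
      if "y \<in> hom_pairs" for y
      using that by (simp add: complexify_pair_hom_pairs hrp1_embed_hom_class)
    show "cmat (split_connection y v) = pinv (stack (complexify_pair y)) **
        stack (frechet_derivative complexify_pair (at y) v)" if "y \<in> hom_pairs" for y v
      unfolding frechet_derivative_at[OF has_derivative_complexify_pair[OF has_derivative_ident], symmetric]
      by (simp add: split_connection_complexify[OF that] cmat_def)
  qed
  have 2: "e (hom_act u q) = e u ** cmat q" for u q
    by (simp add: e_def complexify_pair_hom_act stack_hom_act)
  have 3: "\<exists>N s \<alpha>. u \<in> N \<and> local_section N s \<and> (\<forall>y\<in>N. unitary_frame (e (s y))) \<and>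
      ?C N (\<lambda>y. e (s y)) (\<lambda>y v. cmat (\<alpha> y v)) \<and> (\<forall>y\<in>N. \<forall>v. transpose (\<alpha> y v) = - \<alpha> y v)"
    if "u \<in> hom_pairs" for u :: "real hpair"
  proof -
    obtain N s where uN: "u \<in> N" and ls: "local_section N s"
      and one: "\<And>y. y \<in> N \<Longrightarrow> transpose (stack (s y)) ** stack (s y) = mat 1"
      using split_local_reduction[OF \<open>u \<in> hom_pairs\<close>] by blast
    have N: "open N" "N \<subseteq> hom_pairs" and s: "smooth_on N s" and c: "\<And>y. y \<in> N \<Longrightarrow> s y \<in> hom_class y"
      using ls by (auto simp: local_section_def)
    \<comment> \<open>This is \<open>split_connection\<close> pulled back along \<open>s\<close>,
      whose Gram matrix is the identity.\<close>
    define \<alpha> where "\<alpha> y v = transpose (stack (s y)) ** stack (frechet_derivative s (at y) v)" for y v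
    note ds = smooth_on_has_derivative[OF s]
    have sh: "s y \<in> hom_pairs" "hom_class (s y) = hom_class y" if y: "y \<in> N" for y
    proof -
      have h: "y \<in> hom_pairs" using y N by blast
      then obtain q where "invertible q" "s y = hom_act y q" using c[OF y] by (auto simp: hom_class_eq)
      then show "s y \<in> hom_pairs" "hom_class (s y) = hom_class y"
        using h by (simp_all add: hom_act_hom_pairs hom_class_act)
    qed
    have u: "unitary_frame (e (s y))" if "y \<in> N" for y
      by (simp add: unitary_frame_iff e_def stack_complexify_pair hadj_complexify
          complexify_mult[symmetric] one[OF that] complexify_mat_1)
    \<comment> \<open>As \<open>s y\<close> represents the class of \<open>y\<close>, its
      complexification is a second lift of the same map, and
      \<open>restricted_connection_lift\<close> applies again.\<close>
    have "?C N (\<lambda>y. e (s y)) (\<lambda>y v. cmat (\<alpha> y v))"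
      unfolding e_def
    proof (rule restricted_connection_lift[OF N(1)])
      show "smooth_on N (\<lambda>y. complexify_pair (s y))"
        by (intro smooth_on_linear[OF linear_complexify_pair] s N)
      show "complexify_pair (s y) \<in> hom_pairs \<and> hom_class (complexify_pair (s y)) = hrp1_embed (hom_class y)"
        if "y \<in> N" for y
        using sh[OF that] hrp1_embed_hom_class[of "s y"] by (simp add: complexify_pair_hom_pairs)
      show "cmat (\<alpha> y v) = pinv (stack (complexify_pair (s y))) **
          stack (frechet_derivative (\<lambda>y. complexify_pair (s y)) (at y) v)" if "y \<in> N" for y v
        unfolding frechet_derivative_at[OF has_derivative_complexify_pair[OF ds[OF that]], symmetric]
        by (simp add: split_connection_complexify[OF sh(1)[OF that]] cmat_def split_connection_def
            \<alpha>_def one[OF that] matrix_inv_mat_1)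
    qed
    moreover have "transpose (\<alpha> y v) = - \<alpha> y v" if y: "y \<in> N" for y v
    proof -
      \<comment> \<open>Differentiating the orthonormality relation gives skew-symmetry, that is,
        values in \<open>o(2)\<close>.\<close>
      have "transpose (stack (s y)) ** stack (frechet_derivative s (at y) v)
          + transpose (stack (frechet_derivative s (at y) v)) ** stack (s y) = 0"
        by (rule bilinear_constant_derivative[OF bilinear_gram N(1) y ds[OF y] ds[OF y] one])
      then show ?thesis by (simp add: \<alpha>_def matrix_transpose_mul add_eq_0_iff)
    qed
    ultimately show ?thesis using uN ls u by blast
  qed
  show ?thesis
    unfolding is_basic_split_anti_instanton_def
    using split_extension_split_connection 1 2 3
    by (intro exI[of _ split_connection] exI[of _ e]) blast
qed

theorem proposition2p5:
  shows "is_basic_euclidean_instanton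
           (restricted_connection universal_bundle (projected_connection universal_bundle)
              (\<lambda>x. hc_embed (quat x)))
       \<and> is_basic_split_anti_instanton
           (restricted_connection universal_bundle (projected_connection universal_bundle)
              (\<lambda>u. hrp1_embed (hom_class u)))"
  using is_basic_euclidean_instanton_universal_bundle is_basic_split_anti_instanton_universal_bundle by (rule conjI)

end
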